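(* The conjugacy problem over the lamplighter group $L_2$ is decidable in linear time: there is an algorithm that, given words $u,v$ in the alphabet $\{a^{\pm1},t^{\pm1}\}$, decides in time $O(|u|+|v|)$ whether the elements of $L_2$ they define are conjugate in $L_2$.
   Context: Let $\mathbb{Z}_2^{\mathbb{Z}}$ denote the abelian group of finitely supported functions $f:\mathbb{Z}\to\mathbb{Z}_2$ under pointwise addition, and for $b\in\mathbb{Z}$ put $f^b(x)=f(x+b)$. The lamplighter group is $L_2=\mathbb{Z}\ltimes\mathbb{Z}_2^{\mathbb{Z}}$, the set of pairs $(\delta,f)$ with product $(\delta_1,f_1)(\delta_2,f_2)=(\delta_1+\delta_2,\,f_1^{\delta_2}+f_2)$. It is generated by $a=(0,\mathbf 1_0)$, where $\mathbf 1_0$ is the indicator function of $\{0\}$, and $t=(1,0)$. Elements of $L_2$ are given as words in $a^{\pm1},t^{\pm1}$, and $|w|$ denotes the length of a word $w$. The model of computation is a random-access machine. *)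

theory Defs
  imports
    "HOL-Algebra.Group"
    "HOL-Library.Z2"
    "HOL-Library.Landau_Symbols"
begin

section \<open>Random-access machines\<close>

text \<open>
  A RAM has registers \<open>R 0, R 1, \<dots>\<close> holding natural numbers, all initially \<open>0\<close>, and a
  one-way read-only input tape. The instruction set has addition and truncated subtraction but
  no multiplication, and every instruction costs one time unit.
\<close>

datatype operand =
    Imm nat   \<comment> \<open>the constant \<open>c\<close>\<close>
  | Reg nat   \<comment> \<open>\<open>R r\<close>\<close>
  | Ind nat   \<comment> \<open>\<open>R (R r)\<close>\<close>

datatype instr =
    Assign nat operand   \<comment> \<open>\<open>R r := x\<close>\<close>
  | Store nat operand    \<comment> \<open>\<open>R (R r) := x\<close>\<close>
  | Add nat operand      \<comment> \<open>\<open>R r := R r + x\<close>\<close>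
  | Sub nat operand      \<comment> \<open>\<open>R r := R r - x\<close>, truncated at \<open>0\<close>\<close>
  | Read nat             \<comment> \<open>\<open>R r :=\<close> next input symbol, or \<open>0\<close> once the input is exhausted\<close>
  | Jump nat
  | JumpZero nat nat     \<comment> \<open>\<open>JumpZero r l\<close> jumps to \<open>l\<close> if \<open>R r = 0\<close>\<close>
  | Halt bool            \<comment> \<open>stop with the given answer\<close>

type_synonym program = "instr list"

record config =
  pc :: nat
  regs :: "nat \<Rightarrow> nat"
  inp :: "nat list"

fun operand_val :: "(nat \<Rightarrow> nat) \<Rightarrow> operand \<Rightarrow> nat" where
  "operand_val R (Imm c) = c"
| "operand_val R (Reg r) = R r"
| "operand_val R (Ind r) = R (R r)"

fun exec :: "instr \<Rightarrow> config \<Rightarrow> config" where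
  "exec (Assign r x) c =
     c\<lparr>pc := Suc (pc c), regs := (regs c)(r := operand_val (regs c) x)\<rparr>"
| "exec (Store r x) c =
     c\<lparr>pc := Suc (pc c), regs := (regs c)(regs c r := operand_val (regs c) x)\<rparr>"
| "exec (Add r x) c =
     c\<lparr>pc := Suc (pc c), regs := (regs c)(r := regs c r + operand_val (regs c) x)\<rparr>"
| "exec (Sub r x) c =
     c\<lparr>pc := Suc (pc c), regs := (regs c)(r := regs c r - operand_val (regs c) x)\<rparr>"
| "exec (Read r) c =
     c\<lparr>pc := Suc (pc c),
       regs := (regs c)(r := (case inp c of [] \<Rightarrow> 0 | s # _ \<Rightarrow> s)),
       inp := tl (inp c)\<rparr>"
| "exec (Jump l) c = c\<lparr>pc := l\<rparr>"
| "exec (JumpZero r l) c = c\<lparr>pc := (if regs c r = 0 then l else Suc (pc c))\<rparr>"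
| "exec (Halt b) c = c"

text \<open>Outside the program the machine is stuck, and it never reaches an answer.\<close>

definition step :: "program \<Rightarrow> config \<Rightarrow> config" where
  "step p c = (if pc c < length p then exec (p ! pc c) c else c)"

definition initial :: "nat list \<Rightarrow> config" where
  "initial xs = \<lparr>pc = 0, regs = (\<lambda>_. 0), inp = xs\<rparr>"

definition run :: "program \<Rightarrow> nat list \<Rightarrow> nat \<Rightarrow> config" where
  "run p xs k = (step p ^^ k) (initial xs)"

definition answers :: "program \<Rightarrow> config \<Rightarrow> bool \<Rightarrow> bool" where
  "answers p c b \<longleftrightarrow> pc c < length p \<and> p ! pc c = Halt b"

text \<open>
  On input \<open>xs\<close> the program halts with answer \<open>b\<close> after at most \<open>T\<close> steps, and until then
  all register contents fit into \<open>W\<close> bits.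
\<close>

definition computes_within :: "program \<Rightarrow> nat list \<Rightarrow> bool \<Rightarrow> nat \<Rightarrow> nat \<Rightarrow> bool" where
  "computes_within p xs b T W \<longleftrightarrow>
     (\<exists>k\<le>T. answers p (run p xs k) b \<and> (\<forall>j\<le>k. \<forall>r. regs (run p xs j) r < 2 ^ W))"

text \<open>
  Linear-time decidability of \<open>P\<close>, for instances \<open>x\<close> of size \<open>sz x\<close> given to the machine as
  \<open>enc x\<close>. Registers are restricted to \<open>O(log n)\<close> bits because charging one unit per
  instruction is only realistic for words of that length.
\<close>

definition linear_time_decidable ::
  "('x \<Rightarrow> nat list) \<Rightarrow> ('x \<Rightarrow> nat) \<Rightarrow> ('x \<Rightarrow> bool) \<Rightarrow> bool" where
  "linear_time_decidable enc sz P \<longleftrightarrow>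
     (\<exists>p T W.
        (\<lambda>n. real (T n)) \<in> O(\<lambda>n. real n) \<and>
        (\<lambda>n. real (W n)) \<in> O(\<lambda>n. ln (real n)) \<and>
        (\<forall>x. computes_within p (enc x) (P x) (T (sz x)) (W (sz x))))"


section \<open>The lamplighter group\<close>

definition shift :: "int \<Rightarrow> (int \<Rightarrow> bit) \<Rightarrow> (int \<Rightarrow> bit)" where
  "shift b f = (\<lambda>x. f (x + b))"

definition lamplighter :: "(int \<times> (int \<Rightarrow> bit)) monoid" where
  "lamplighter =
     \<lparr>carrier = {(\<delta>, f). finite {x. f x \<noteq> 0}},
      mult = (\<lambda>(\<delta>1, f1) (\<delta>2, f2). (\<delta>1 + \<delta>2, (\<lambda>x. shift \<delta>2 f1 x + f2 x))),
      one = (0, \<lambda>_. 0)\<rparr>"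

lemma finite_support_shift:
  assumes "finite {x. f x \<noteq> 0}"
  shows "finite {x. shift b f x \<noteq> 0}"
proof -
  have "{x. shift b f x \<noteq> 0} = (\<lambda>x. x - b) ` {x. f x \<noteq> 0}"
    by (force simp: shift_def image_iff)
  then show ?thesis using assms by simp
qed

lemma finite_support_add:
  fixes f g :: "int \<Rightarrow> bit"
  assumes "finite {x. f x \<noteq> 0}" "finite {x. g x \<noteq> 0}"
  shows "finite {x. f x + g x \<noteq> 0}"
  by (rule finite_subset[OF _ finite_UnI[OF assms]]) auto

lemma group_lamplighter: "group lamplighter"
proof (rule groupI)
  fix x assume "x \<in> carrier lamplighter"
  then obtain \<delta> f where x: "x = (\<delta>, f)" "finite {x. f x \<noteq> 0}"
    by (auto simp: lamplighter_def)
  have "(- \<delta>, shift (- \<delta>) f) \<in> carrier lamplighter"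
    using finite_support_shift[OF x(2)] by (simp add: lamplighter_def)
  moreover have "(- \<delta>, shift (- \<delta>) f) \<otimes>\<^bsub>lamplighter\<^esub> x = \<one>\<^bsub>lamplighter\<^esub>"
    by (auto simp: x lamplighter_def shift_def fun_eq_iff)
  ultimately show "\<exists>y\<in>carrier lamplighter. y \<otimes>\<^bsub>lamplighter\<^esub> x = \<one>\<^bsub>lamplighter\<^esub>" ..
next
  fix x y assume "x \<in> carrier lamplighter" "y \<in> carrier lamplighter"
  then obtain \<delta>1 f1 \<delta>2 f2
    where x: "x = (\<delta>1, f1)" "finite {x. f1 x \<noteq> 0}" and y: "y = (\<delta>2, f2)" "finite {x. f2 x \<noteq> 0}"
    by (auto simp: lamplighter_def)
  show "x \<otimes>\<^bsub>lamplighter\<^esub> y \<in> carrier lamplighter"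
    using finite_support_add[OF finite_support_shift[OF x(2)] y(2)]
    by (simp add: x(1) y(1) lamplighter_def)
qed (auto simp: lamplighter_def shift_def algebra_simps fun_eq_iff)

definition gen_a :: "int \<times> (int \<Rightarrow> bit)" where
  "gen_a = (0, \<lambda>x. if x = 0 then 1 else 0)"

definition gen_t :: "int \<times> (int \<Rightarrow> bit)" where
  "gen_t = (1, \<lambda>_. 0)"

datatype letter = A_pos | A_neg | T_pos | T_neg

fun letter_val :: "letter \<Rightarrow> int \<times> (int \<Rightarrow> bit)" where
  "letter_val A_pos = gen_a"
| "letter_val A_neg = inv\<^bsub>lamplighter\<^esub> gen_a"
| "letter_val T_pos = gen_t"
| "letter_val T_neg = inv\<^bsub>lamplighter\<^esub> gen_t"

definition word_val :: "letter list \<Rightarrow> int \<times> (int \<Rightarrow> bit)" where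
  "word_val w = foldr (\<lambda>l g. letter_val l \<otimes>\<^bsub>lamplighter\<^esub> g) w \<one>\<^bsub>lamplighter\<^esub>"

definition conjugate_in :: "('a, 'b) monoid_scheme \<Rightarrow> 'a \<Rightarrow> 'a \<Rightarrow> bool" where
  "conjugate_in G x y \<longleftrightarrow> (\<exists>g\<in>carrier G. y = inv\<^bsub>G\<^esub> g \<otimes>\<^bsub>G\<^esub> x \<otimes>\<^bsub>G\<^esub> g)"

fun letter_code :: "letter \<Rightarrow> nat" where
  "letter_code A_pos = 1"
| "letter_code A_neg = 2"
| "letter_code T_pos = 3"
| "letter_code T_neg = 4"

text \<open>One tape cell per letter; \<open>0\<close> separates the two words and also marks the end of the input.\<close>

definition encode_pair :: "letter list \<times> letter list \<Rightarrow> nat list" where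
  "encode_pair = (\<lambda>(u, v). map letter_code u @ [0] @ map letter_code v @ [0])"

end

theory Submission
  imports Defs
begin

text \<open>
  Conjugating \<open>(\<delta>, f)\<close> by \<open>(c, h)\<close> gives \<open>(\<delta>, f\<^sup>c + h\<^sup>\<delta> + h)\<close>. For \<open>\<delta> \<noteq> 0\<close> the functions
  \<open>h\<^sup>\<delta> + h\<close> are exactly those whose sum over every residue class modulo \<open>\<bar>\<delta>\<bar>\<close> vanishes, so \<open>(\<delta>, f)\<close> and
  \<open>(\<delta>, g)\<close> are conjugate iff folding \<open>f\<close> and \<open>g\<close> modulo \<open>\<bar>\<delta>\<bar>\<close> yields the same cyclic word up to
  rotation. For \<open>\<delta> = 0\<close> the functions must be translates of each other, and this is the same criterion
  for any modulus larger than four times the extent of their supports. Translating \<open>f\<close> does not matter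
  either, so a letter \<open>a\<close> may be recorded at the height reached so far.

  Equality of two cyclic words of length \<open>N\<close> is tested in linear time by comparing the rotation at \<open>i\<close>
  of the first with the rotation at \<open>j\<close> of the second. If they agree in \<open>k\<close> letters and the next letter
  is larger in the first word, then none of the rotations at \<open>i, \<dots>, i + k\<close> of the first word is
  minimal unless the words are inequivalent, and \<open>i\<close> advances to \<open>i + k + 1\<close>; symmetrically for \<open>j\<close>.
  Each comparison increases \<open>i + j + k\<close> by one.
\<close>

section \<open>Structured programs on random-access machines\<close>

datatype com =
    Skip
  | Basic instr
  | Seq com com (infixr \<open>;;\<close> 60)
  | IfZero nat com com
  | While nat com

primrec clen :: "com \<Rightarrow> nat" where
  "clen Skip = 0"
| "clen (Basic i) = 1"
| "clen (c1 ;; c2) = clen c1 + clen c2"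
| "clen (IfZero r c1 c2) = clen c1 + clen c2 + 2"
| "clen (While r c) = clen c + 2"

text \<open>Jump targets are absolute, hence the start address \<open>a\<close>. In
  \<open>IfZero\<close> the code of the nonzero branch comes first, since \<open>JumpZero\<close>
  falls through on a nonzero register; only that branch ends in a jump.\<close>

primrec compile :: "com \<Rightarrow> nat \<Rightarrow> program" where
  "compile Skip a = []"
| "compile (Basic i) a = [i]"
| "compile (c1 ;; c2) a = compile c1 a @ compile c2 (a + clen c1)"
| "compile (IfZero r c1 c2) a =
     JumpZero r (a + clen c2 + 2) # compile c2 (Suc a)
       @ Jump (a + clen c1 + clen c2 + 2) # compile c1 (a + clen c2 + 2)"
| "compile (While r c) a = JumpZero r (a + clen c + 2) # compile c (Suc a) @ [Jump a]"

lemma length_compile [simp]: "length (compile c a) = clen c"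
  by (induction c arbitrary: a) auto

section \<open>Traces with bounded registers\<close>

definition exec_steps :: "program \<Rightarrow> nat \<Rightarrow> config \<Rightarrow> nat \<Rightarrow> config \<Rightarrow> bool" where
  "exec_steps p M s k s' \<longleftrightarrow>
     (step p ^^ k) s = s' \<and> (\<forall>j\<le>k. \<forall>r. regs ((step p ^^ j) s) r < M)"

lemma exec_steps_0: "(\<And>r. regs s r < M) \<Longrightarrow> exec_steps p M s 0 s"
  by (simp add: exec_steps_def)

lemma exec_steps_1:
  assumes "step p s = s'" "\<And>r. regs s r < M" "\<And>r. regs s' r < M"
  shows "exec_steps p M s (Suc 0) s'"
  using assms by (auto simp: exec_steps_def le_Suc_eq)

lemma exec_steps_trans:
  assumes "exec_steps p M s k s'" "exec_steps p M s' l s''"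
  shows "exec_steps p M s (k + l) s''"
proof -
  have "regs ((step p ^^ j) s) r < M" if "j \<le> k + l" for j r
  proof (cases "j \<le> k")
    case False
    then have "(step p ^^ j) s = (step p ^^ (j - k)) s'"
      using assms(1) funpow_add[of "j - k" k "step p"] by (simp add: exec_steps_def)
    with False that show ?thesis using assms(2) by (simp add: exec_steps_def)
  qed (use assms(1) in \<open>simp add: exec_steps_def\<close>)
  moreover have "(step p ^^ (k + l)) s = s''"
    using assms funpow_add[of l k "step p"] by (simp add: exec_steps_def add.commute)
  ultimately show ?thesis by (simp add: exec_steps_def)
qed

text \<open>
  Assertions speak about the registers, the remaining input and the number of steps made so far;
  \<open>wp M\<close> also demands that the registers stay below \<open>M\<close>. Since the assertion sees the clock,
  invariants bound running times.
\<close>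

type_synonym assn = "(nat \<Rightarrow> nat) \<Rightarrow> nat list \<Rightarrow> nat \<Rightarrow> bool"

definition wp :: "nat \<Rightarrow> com \<Rightarrow> assn \<Rightarrow> assn" where
  "wp M c Q R xs n \<longleftrightarrow> ((\<forall>r. R r < M) \<longrightarrow>
     (\<forall>l r. \<exists>k R' xs'.
        exec_steps (l @ compile c (length l) @ r) M
          \<lparr>pc = length l, regs = R, inp = xs\<rparr> k
          \<lparr>pc = length l + clen c, regs = R', inp = xs'\<rparr>
        \<and> Q R' xs' (n + k)))"

lemma exec_steps_bounded:
  "exec_steps p M s k \<lparr>pc = a, regs = R, inp = xs\<rparr> \<Longrightarrow> R r < M"
  by (force simp: exec_steps_def)

lemma wp_mono:
  assumes "wp M c Q R xs n"
    and "\<And>R xs n. Q R xs n \<Longrightarrow> Q' R xs n"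
  shows "wp M c Q' R xs n"
  using assms unfolding wp_def by blast

lemma wp_clock_mono:
  assumes "wp M c Q R xs n"
  shows "wp M c (\<lambda>R xs n'. n \<le> n' \<and> Q R xs n') R xs n"
  using assms unfolding wp_def by (metis le_add1)

lemma wp_Skip: "Q R xs n \<Longrightarrow> wp M Skip Q R xs n"
  unfolding wp_def
proof (intro impI allI)
  fix l r assume "Q R xs n" and R: "\<forall>r. R r < M"
  then show "\<exists>k R' xs'.
      exec_steps (l @ compile Skip (length l) @ r) M
        \<lparr>pc = length l, regs = R, inp = xs\<rparr> k
        \<lparr>pc = length l + clen Skip, regs = R', inp = xs'\<rparr> \<and> Q R' xs' (n + k)"
    by (intro exI[of _ 0] exI[of _ R] exI[of _ xs]) (simp add: exec_steps_0)
qed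

lemma wp_Basic:
  assumes "\<And>a. exec i \<lparr>pc = a, regs = R, inp = xs\<rparr> = \<lparr>pc = Suc a, regs = R', inp = xs'\<rparr>"
    and "(\<And>r. R r < M) \<Longrightarrow> (\<And>r. R' r < M)"
    and "Q R' xs' (Suc n)"
  shows "wp M (Basic i) Q R xs n"
  unfolding wp_def
proof (intro impI allI)
  fix l r assume R: "\<forall>r. R r < M"
  have "exec_steps (l @ compile (Basic i) (length l) @ r) M
      \<lparr>pc = length l, regs = R, inp = xs\<rparr> (Suc 0)
      \<lparr>pc = length l + clen (Basic i), regs = R', inp = xs'\<rparr>"
    by (rule exec_steps_1) (use R assms(1,2) in \<open>auto simp: step_def\<close>)
  with assms(3) show "\<exists>k R' xs'.
      exec_steps (l @ compile (Basic i) (length l) @ r) M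
        \<lparr>pc = length l, regs = R, inp = xs\<rparr> k
        \<lparr>pc = length l + clen (Basic i), regs = R', inp = xs'\<rparr> \<and> Q R' xs' (n + k)"
    by fastforce
qed

lemma wp_Seq:
  assumes "wp M c1 (wp M c2 Q) R xs n"
  shows "wp M (c1 ;; c2) Q R xs n"
  unfolding wp_def
proof (intro impI allI)
  fix l r assume R: "\<forall>r. R r < M"
  let ?p = "l @ compile (c1 ;; c2) (length l) @ r"
  let ?C1 = "compile c1 (length l)"
  obtain k R1 xs1 where 1: "exec_steps ?p M \<lparr>pc = length l, regs = R, inp = xs\<rparr> k
        \<lparr>pc = length l + clen c1, regs = R1, inp = xs1\<rparr>" "wp M c2 Q R1 xs1 (n + k)"
    using assms R unfolding wp_def[of M c1]
    by (metis append.assoc compile.simps(3))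
  from 1(1) have "\<forall>r. R1 r < M" by (blast intro: exec_steps_bounded)
  \<comment> \<open>The universally quantified prefix in \<open>wp\<close> is instantiated with
    \<open>l\<close> followed by the code of \<open>c1\<close>.\<close>
  with 1(2) obtain m R2 xs2 where 2:
    "exec_steps ((l @ ?C1) @ compile c2 (length (l @ ?C1)) @ r) M
       \<lparr>pc = length (l @ ?C1), regs = R1, inp = xs1\<rparr> m
       \<lparr>pc = length (l @ ?C1) + clen c2, regs = R2, inp = xs2\<rparr>" "Q R2 xs2 (n + k + m)"
    unfolding wp_def by blast
  have "exec_steps ?p M \<lparr>pc = length l, regs = R, inp = xs\<rparr> (k + m)
      \<lparr>pc = length l + clen (c1 ;; c2), regs = R2, inp = xs2\<rparr>"
    using exec_steps_trans[OF 1(1)] 2(1) by (simp add: add.assoc)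
  with 2(2) show "\<exists>k R' xs'. exec_steps ?p M \<lparr>pc = length l, regs = R, inp = xs\<rparr> k
      \<lparr>pc = length l + clen (c1 ;; c2), regs = R', inp = xs'\<rparr> \<and> Q R' xs' (n + k)"
    by (metis add.assoc)
qed

lemma step_JumpZero:
  "step (l @ JumpZero r a # p) \<lparr>pc = length l, regs = R, inp = xs\<rparr> =
     \<lparr>pc = if R r = 0 then a else Suc (length l), regs = R, inp = xs\<rparr>"
  by (simp add: step_def)

lemma step_Jump:
  "b = length l \<Longrightarrow> step (l @ Jump a # p) \<lparr>pc = b, regs = R, inp = xs\<rparr> = \<lparr>pc = a, regs = R, inp = xs\<rparr>"
  by (simp add: step_def)

text \<open>The test costs one step in both branches; the nonzero branch pays another one for the
  jump over the code of \<open>c1\<close>, charged in its postcondition.\<close>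

lemma wp_IfZero:
  assumes "R r = 0 \<Longrightarrow> wp M c1 Q R xs (Suc n)"
    and "R r \<noteq> 0 \<Longrightarrow> wp M c2 (\<lambda>R xs n. Q R xs (Suc n)) R xs (Suc n)"
  shows "wp M (IfZero r c1 c2) Q R xs n"
  unfolding wp_def
proof (intro impI allI)
  fix l q assume R: "\<forall>r. R r < M"
  let ?p = "l @ compile (IfZero r c1 c2) (length l) @ q"
  let ?s = "\<lparr>pc = length l, regs = R, inp = xs\<rparr>"
  let ?b = "length l + clen c1 + clen c2 + 2"
  let ?C2 = "compile c2 (Suc (length l))"
  let ?C1 = "compile c1 (length l + clen c2 + 2)"
  let ?J1 = "JumpZero r (length l + clen c2 + 2)" and ?J2 = "Jump ?b"
  have st: "step ?p ?s = \<lparr>pc = if R r = 0 then length l + clen c2 + 2 else Suc (length l), regs = R, inp = xs\<rparr>"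
    using step_JumpZero by simp
  have "\<exists>k R' xs'. exec_steps ?p M ?s k \<lparr>pc = ?b, regs = R', inp = xs'\<rparr> \<and> Q R' xs' (n + k)"
  proof (cases "R r = 0")
    case True
    let ?l = "l @ [?J1] @ ?C2 @ [?J2]"
    obtain k R' xs' where 1: "exec_steps (?l @ compile c1 (length ?l) @ q) M
       \<lparr>pc = length ?l, regs = R, inp = xs\<rparr> k
       \<lparr>pc = length ?l + clen c1, regs = R', inp = xs'\<rparr>" "Q R' xs' (Suc n + k)"
      using assms(1)[OF True] R unfolding wp_def by blast
    have "exec_steps ?p M ?s (Suc 0) \<lparr>pc = length ?l, regs = R, inp = xs\<rparr>"
      by (rule exec_steps_1) (use st True R in auto)
    moreover have "exec_steps ?p M \<lparr>pc = length ?l, regs = R, inp = xs\<rparr> k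
       \<lparr>pc = ?b, regs = R', inp = xs'\<rparr>"
      using 1(1) by (simp add: algebra_simps)
    ultimately have "exec_steps ?p M ?s (Suc k) \<lparr>pc = ?b, regs = R', inp = xs'\<rparr>"
      using exec_steps_trans by fastforce
    with 1(2) show ?thesis by (metis add_Suc_shift)
  next
    case False
    let ?l = "l @ [?J1]"
    let ?q = "?J2 # ?C1 @ q"
    obtain k R' xs' where 1: "exec_steps (?l @ compile c2 (length ?l) @ ?q) M
       \<lparr>pc = length ?l, regs = R, inp = xs\<rparr> k
       \<lparr>pc = length ?l + clen c2, regs = R', inp = xs'\<rparr>" "Q R' xs' (Suc (Suc n + k))"
      using assms(2)[OF False] R unfolding wp_def by blast
    have "exec_steps ?p M ?s (Suc 0) \<lparr>pc = length ?l, regs = R, inp = xs\<rparr>"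
      by (rule exec_steps_1) (use st False R in auto)
    moreover have 2: "exec_steps ?p M \<lparr>pc = length ?l, regs = R, inp = xs\<rparr> k
       \<lparr>pc = length ?l + clen c2, regs = R', inp = xs'\<rparr>"
      using 1(1) by simp
    moreover have "exec_steps ?p M \<lparr>pc = length ?l + clen c2, regs = R', inp = xs'\<rparr> (Suc 0)
       \<lparr>pc = ?b, regs = R', inp = xs'\<rparr>"
      using step_Jump[of "length ?l + clen c2" "l @ [?J1] @ ?C2" ?b "?C1 @ q" R' xs']
        exec_steps_bounded[OF 2]
      by (intro exec_steps_1) auto
    ultimately have "exec_steps ?p M ?s (Suc 0 + k + Suc 0) \<lparr>pc = ?b, regs = R', inp = xs'\<rparr>"
      using exec_steps_trans by blast
    with 1(2) show ?thesis by (intro exI[of _ "Suc 0 + k + Suc 0"] exI) auto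
  qed
  then show "\<exists>k R' xs'. exec_steps ?p M ?s k
      \<lparr>pc = length l + clen (IfZero r c1 c2), regs = R', inp = xs'\<rparr> \<and> Q R' xs' (n + k)"
    by (simp add: add.assoc)
qed

lemma wp_While_unfold:
  assumes "R r = 0 \<Longrightarrow> Q R xs (Suc n)"
    and "R r \<noteq> 0 \<Longrightarrow> wp M c (\<lambda>R xs n. wp M (While r c) Q R xs (Suc n)) R xs (Suc n)"
  shows "wp M (While r c) Q R xs n"
  unfolding wp_def
proof (intro impI allI)
  fix l q assume R: "\<forall>r. R r < M"
  let ?p = "l @ compile (While r c) (length l) @ q"
  let ?s = "\<lambda>R xs. \<lparr>pc = length l, regs = R, inp = xs\<rparr>"
  let ?C = "compile c (Suc (length l))"
  let ?J1 = "JumpZero r (length l + clen c + 2)" and ?J2 = "Jump (length l)"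
  have st: "step ?p (?s R xs) = \<lparr>pc = if R r = 0 then length l + clen c + 2 else Suc (length l), regs = R, inp = xs\<rparr>"
    using step_JumpZero by simp
  show "\<exists>k R' xs'. exec_steps ?p M (?s R xs) k
      \<lparr>pc = length l + clen (While r c), regs = R', inp = xs'\<rparr> \<and> Q R' xs' (n + k)"
  proof (cases "R r = 0")
    case True
    then have "exec_steps ?p M (?s R xs) (Suc 0) \<lparr>pc = length l + clen (While r c), regs = R, inp = xs\<rparr>"
      using st R by (intro exec_steps_1) auto
    with assms(1)[OF True] show ?thesis by (intro exI[of _ "Suc 0"] exI) auto
  next
    case False
    let ?l = "l @ [?J1]"
    obtain k R1 xs1 where 1: "exec_steps (?l @ compile c (length ?l) @ ?J2 # q) M
       \<lparr>pc = length ?l, regs = R, inp = xs\<rparr> k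
       \<lparr>pc = length ?l + clen c, regs = R1, inp = xs1\<rparr>"
       "wp M (While r c) Q R1 xs1 (Suc (Suc n + k))"
      using assms(2)[OF False] R unfolding wp_def[of M c] by blast
    have "exec_steps ?p M (?s R xs) (Suc 0) \<lparr>pc = length ?l, regs = R, inp = xs\<rparr>"
      by (rule exec_steps_1) (use st False R in auto)
    moreover have 2: "exec_steps ?p M \<lparr>pc = length ?l, regs = R, inp = xs\<rparr> k
       \<lparr>pc = length ?l + clen c, regs = R1, inp = xs1\<rparr>"
      using 1(1) by simp
    moreover have "exec_steps ?p M \<lparr>pc = length ?l + clen c, regs = R1, inp = xs1\<rparr> (Suc 0) (?s R1 xs1)"
      using step_Jump[of "length ?l + clen c" "l @ [?J1] @ ?C" "length l" q R1 xs1]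
        exec_steps_bounded[OF 2]
      by (intro exec_steps_1) auto
    ultimately have 3: "exec_steps ?p M (?s R xs) (Suc 0 + k + Suc 0) (?s R1 xs1)"
      using exec_steps_trans by blast
    then have "\<forall>r. R1 r < M" by (blast intro: exec_steps_bounded)
    with 1(2) obtain m R' xs' where 4: "exec_steps ?p M (?s R1 xs1) m
        \<lparr>pc = length l + clen (While r c), regs = R', inp = xs'\<rparr>" "Q R' xs' (Suc (Suc n + k) + m)"
      unfolding wp_def[of M "While r c"] by blast
    have "exec_steps ?p M (?s R xs) (Suc 0 + k + Suc 0 + m)
        \<lparr>pc = length l + clen (While r c), regs = R', inp = xs'\<rparr>"
      using exec_steps_trans[OF 3 4(1)] .
    with 4(2) show ?thesis
      by (intro exI[of _ "Suc 0 + k + Suc 0 + m"] exI) (auto simp: add.assoc)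
  qed
qed

text \<open>The clock itself is the termination measure.\<close>

lemma wp_While:
  assumes "I R xs n"
    and body: "\<And>R xs n. I R xs n \<Longrightarrow> R r \<noteq> 0 \<Longrightarrow> wp M c (\<lambda>R xs n. I R xs (Suc n)) R xs (Suc n)"
    and exit: "\<And>R xs n. I R xs n \<Longrightarrow> R r = 0 \<Longrightarrow> Q R xs (Suc n)"
    and bound: "\<And>R xs n. I R xs n \<Longrightarrow> n \<le> B"
  shows "wp M (While r c) Q R xs n"
  using assms(1)
proof (induction "B - n" arbitrary: R xs n rule: less_induct)
  case less
  show ?case
  proof (rule wp_While_unfold)
    assume "R r \<noteq> 0"
    show "wp M c (\<lambda>R xs n. wp M (While r c) Q R xs (Suc n)) R xs (Suc n)"
    proof (rule wp_mono[OF wp_clock_mono[OF body[OF less.prems \<open>R r \<noteq> 0\<close>]]])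
      fix R xs n' assume "Suc n \<le> n' \<and> I R xs (Suc n')"
      with bound[of R xs "Suc n'"] show "wp M (While r c) Q R xs (Suc n')"
        by (intro less.hyps) auto
    qed
  qed (use less.prems exit in blast)
qed

section \<open>Verification conditions for loop-free code\<close>

primrec imm_below :: "nat \<Rightarrow> operand \<Rightarrow> bool" where
  "imm_below M (Imm c) \<longleftrightarrow> c < M"
| "imm_below M (Reg r) \<longleftrightarrow> True"
| "imm_below M (Ind r) \<longleftrightarrow> True"

lemma operand_val_below: "imm_below M x \<Longrightarrow> (\<And>r. R r < M) \<Longrightarrow> operand_val R x < M"
  by (cases x) auto

text \<open>The bound \<open>M\<close> is checked only where a value can violate it: at constants,
  sums and input symbols. Copies and truncated differences stay below \<open>M\<close> because all
  registers do. Jumps and \<open>Halt\<close> are rejected, as control flow is produced by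
  \<open>compile\<close> alone.\<close>

fun vc_instr :: "nat \<Rightarrow> instr \<Rightarrow> assn \<Rightarrow> assn" where
  "vc_instr M (Assign r x) Q R xs n \<longleftrightarrow>
     imm_below M x \<and> Q (R(r := operand_val R x)) xs (Suc n)"
| "vc_instr M (Store r x) Q R xs n \<longleftrightarrow>
     imm_below M x \<and> Q (R(R r := operand_val R x)) xs (Suc n)"
| "vc_instr M (Add r x) Q R xs n \<longleftrightarrow>
     R r + operand_val R x < M \<and> Q (R(r := R r + operand_val R x)) xs (Suc n)"
| "vc_instr M (Sub r x) Q R xs n \<longleftrightarrow> Q (R(r := R r - operand_val R x)) xs (Suc n)"
| "vc_instr M (Read r) Q R xs n \<longleftrightarrow>
     (case xs of [] \<Rightarrow> 0 | s # _ \<Rightarrow> s) < M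
     \<and> Q (R(r := (case xs of [] \<Rightarrow> 0 | s # _ \<Rightarrow> s))) (tl xs) (Suc n)"
| "vc_instr M _ Q R xs n \<longleftrightarrow> False"

text \<open>
  Strengthens \<open>wp\<close> to a form that the simplifier evaluates on loop-free programs.
\<close>

primrec vc :: "nat \<Rightarrow> com \<Rightarrow> assn \<Rightarrow> assn" where
  "vc M Skip Q = Q"
| "vc M (Basic i) Q = vc_instr M i Q"
| "vc M (c1 ;; c2) Q = vc M c1 (vc M c2 Q)"
| "vc M (IfZero r c1 c2) Q = (\<lambda>R xs n.
     if R r = 0 then vc M c1 Q R xs (Suc n)
     else vc M c2 (\<lambda>R xs n. Q R xs (Suc n)) R xs (Suc n))"
| "vc M (While r c) Q = wp M (While r c) Q"

lemma vc_sound: "vc M c Q R xs n \<Longrightarrow> wp M c Q R xs n"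
proof (induction c arbitrary: Q R xs n)
  case Skip
  then show ?case by (simp add: wp_Skip)
next
  case (Basic i)
  have val: "operand_val R x < M" if "imm_below M x" "\<And>r. R r < M" for x
    using operand_val_below that by blast
  show ?case
    by (cases i; rule wp_Basic)
      (use Basic val in \<open>auto simp: less_imp_diff_less\<close>)
next
  case (Seq c1 c2)
  have "wp M c1 (vc M c2 Q) R xs n" using Seq by simp
  then show ?case using Seq.IH(2) by (blast intro: wp_Seq wp_mono)
next
  case (IfZero r c1 c2)
  then show ?case by (intro wp_IfZero) auto
qed simp

lemma wp_Basic_Seq: "vc_instr M i (wp M c Q) R xs n \<Longrightarrow> wp M (Basic i ;; c) Q R xs n"
  by (intro wp_Seq vc_sound) simp

definition decision_program :: "com \<Rightarrow> nat \<Rightarrow> program" where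
  "decision_program c r = compile c 0 @ [JumpZero r (clen c + 2), Halt True, Halt False]"

text \<open>The strict inequality \<open>n < T\<close> leaves one step for the final
  \<open>JumpZero\<close>, after which the machine stands on the \<open>Halt\<close> that carries
  the answer.\<close>

lemma computes_within_decision_program:
  assumes "wp (2 ^ W) c (\<lambda>R xs n. n < T \<and> (R r \<noteq> 0 \<longleftrightarrow> b)) (\<lambda>_. 0) xs 0"
  shows "computes_within (decision_program c r) xs b T W"
proof -
  let ?p = "decision_program c r"
  obtain k R ys where 1: "exec_steps ?p (2 ^ W) (initial xs) k \<lparr>pc = clen c, regs = R, inp = ys\<rparr>"
    and 2: "k < T" "R r \<noteq> 0 \<longleftrightarrow> b"
    using assms[unfolded wp_def, rule_format, of "[]" "[JumpZero r (clen c + 2), Halt True, Halt False]"]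
    by (auto simp: decision_program_def initial_def)
  let ?s = "\<lparr>pc = if R r = 0 then clen c + 2 else Suc (clen c), regs = R, inp = ys\<rparr>"
  have "step ?p \<lparr>pc = clen c, regs = R, inp = ys\<rparr> = ?s"
    using step_JumpZero[of "compile c 0"] by (simp add: decision_program_def)
  then have "exec_steps ?p (2 ^ W) \<lparr>pc = clen c, regs = R, inp = ys\<rparr> (Suc 0) ?s"
    using exec_steps_bounded[OF 1] by (intro exec_steps_1) auto
  from exec_steps_trans[OF 1 this] have "exec_steps ?p (2 ^ W) (initial xs) (Suc k) ?s" by simp
  moreover have "answers ?p ?s b"
    using 2(2) by (auto simp: answers_def decision_program_def nth_append)
  ultimately show ?thesis
    using 2(1) unfolding computes_within_def run_def exec_steps_def
    by (intro exI[of _ "Suc k"]) auto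
qed


section \<open>Comparing cyclic words\<close>

text \<open>
  Cyclic words of length \<open>N\<close> are represented by \<open>N\<close>-periodic sequences \<open>\<alpha>\<close>; the rotation at \<open>p\<close>
  is \<open>\<lambda>k. \<alpha> (p + k)\<close>.
\<close>

definition rotation_gt :: "(nat \<Rightarrow> nat) \<Rightarrow> nat \<Rightarrow> (nat \<Rightarrow> nat) \<Rightarrow> nat \<Rightarrow> bool" where
  "rotation_gt \<alpha> p \<beta> q \<longleftrightarrow> (\<exists>k. \<alpha> (p + k) > \<beta> (q + k) \<and> (\<forall>l<k. \<alpha> (p + l) = \<beta> (q + l)))"

lemma rotation_gt_trans:
  assumes "rotation_gt \<alpha> p \<beta> q" "rotation_gt \<beta> q \<gamma> r"
  shows "rotation_gt \<alpha> p \<gamma> r"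
proof -
  obtain k where k: "\<alpha> (p + k) > \<beta> (q + k)" "\<forall>l<k. \<alpha> (p + l) = \<beta> (q + l)"
    using assms(1) by (auto simp: rotation_gt_def)
  obtain m where m: "\<beta> (q + m) > \<gamma> (r + m)" "\<forall>l<m. \<beta> (q + l) = \<gamma> (r + l)"
    using assms(2) by (auto simp: rotation_gt_def)
  show ?thesis unfolding rotation_gt_def
    by (rule exI[of _ "min k m"], cases k m rule: linorder_cases) (use k m in auto)
qed

lemma rotation_gt_irrefl: "\<not> rotation_gt \<alpha> p \<alpha> p"
  by (simp add: rotation_gt_def)

lemma rotation_gt_cong:
  assumes "\<And>k. \<alpha> (p + k) = \<alpha>' (p' + k)" "\<And>k. \<beta> (q + k) = \<beta>' (q' + k)"
  shows "rotation_gt \<alpha> p \<beta> q \<longleftrightarrow> rotation_gt \<alpha>' p' \<beta>' q'"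
  by (simp add: rotation_gt_def assms)

section \<open>Periodic sequences and minimal rotations\<close>

definition periodic :: "nat \<Rightarrow> (nat \<Rightarrow> 'a) \<Rightarrow> bool" where
  "periodic N \<alpha> \<longleftrightarrow> (\<forall>k. \<alpha> (k + N) = \<alpha> k)"

lemma periodic_mod:
  assumes "periodic N \<alpha>"
  shows "\<alpha> (k mod N) = \<alpha> k"
proof -
  have "\<alpha> (m + j * N) = \<alpha> m" for m j
  proof (induction j)
    case (Suc j)
    have "\<alpha> (m + Suc j * N) = \<alpha> ((m + j * N) + N)" by (simp add: algebra_simps)
    with Suc assms show ?case by (simp add: periodic_def)
  qed simp
  from this[of "k mod N" "k div N"] show ?thesis by simp
qed

text \<open>\<open>rotation_gt\<close> is a strict lexicographic order, and by periodicity only the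
  rotations at \<open>0, ..., N - 1\<close> matter. This finite set has a minimal element, which
  exceeds no rotation at all.\<close>

lemma rotation_gt_not_total:
  assumes "0 < N" and per: "periodic N \<alpha>"
  shows "\<exists>p<N. \<forall>q. \<not> rotation_gt \<alpha> p \<alpha> q"
proof (rule ccontr)
  assume *: "\<not> ?thesis"
  have red: "rotation_gt \<alpha> p \<alpha> q \<longleftrightarrow> rotation_gt \<alpha> p \<alpha> (q mod N)" for p q
  proof (rule rotation_gt_cong)
    show "\<alpha> (q + k) = \<alpha> (q mod N + k)" for k
      using periodic_mod[OF per, of "q + k"] periodic_mod[OF per, of "q mod N + k"]
      by (simp add: mod_add_left_eq)
  qed simp
  \<comment> \<open>Minimality is stated for a "smaller than" relation, so
    \<open>rotation_gt\<close> enters with its arguments exchanged.\<close>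
  have "\<exists>m\<in>{..<N}. \<forall>x\<in>{..<N}. x \<noteq> m \<longrightarrow> \<not> rotation_gt \<alpha> m \<alpha> x"
  proof (rule Finite_Set.bex_min_element)
    show "asymp_on {..<N} (\<lambda>x m. rotation_gt \<alpha> m \<alpha> x)"
      by (rule asymp_onI) (use rotation_gt_trans rotation_gt_irrefl in blast)
    show "transp_on {..<N} (\<lambda>x m. rotation_gt \<alpha> m \<alpha> x)"
      by (rule transp_onI) (use rotation_gt_trans in blast)
  qed (use assms(1) in auto)
  then obtain m where m: "m < N" "\<And>x. x < N \<Longrightarrow> x \<noteq> m \<Longrightarrow> \<not> rotation_gt \<alpha> m \<alpha> x" by auto
  obtain q where "rotation_gt \<alpha> m \<alpha> q" using * m(1) by blast
  then have "rotation_gt \<alpha> m \<alpha> (q mod N)" using red by simp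
  then show False
    using m(2)[of "q mod N"] rotation_gt_irrefl assms(1) by (cases "q mod N = m") auto
qed

definition is_rotation :: "(nat \<Rightarrow> nat) \<Rightarrow> (nat \<Rightarrow> nat) \<Rightarrow> bool" where
  "is_rotation \<alpha> \<beta> \<longleftrightarrow> (\<exists>c. \<forall>k. \<beta> k = \<alpha> (k + c))"

text \<open>A shift by \<open>c\<close> is undone by a shift by \<open>c * (N - 1)\<close>, since
  together they make the multiple \<open>c * N\<close> of the period; no negative offset is
  needed.\<close>

lemma is_rotation_sym:
  assumes "0 < N" and per: "periodic N \<alpha>"
    and "is_rotation \<alpha> \<beta>"
  shows "is_rotation \<beta> \<alpha>"
proof -
  obtain c where c: "\<And>k. \<beta> k = \<alpha> (k + c)" using assms(3) by (auto simp: is_rotation_def)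
  have "\<alpha> k = \<beta> (k + c * (N - 1))" for k
  proof -
    have "k + c * (N - 1) + c = k + c * N" using assms(1) by (cases N) (auto simp: algebra_simps)
    then show ?thesis
      using periodic_mod[OF per, of "k + c * N"] periodic_mod[OF per, of k]
      by (simp only: c mod_mult_self1)
  qed
  then show ?thesis by (auto simp: is_rotation_def)
qed

text \<open>
  A minimal rotation of \<open>\<alpha>\<close> would exceed some rotation of \<open>\<beta>\<close>, which is a rotation of \<open>\<alpha>\<close> as well.
\<close>

lemma not_is_rotation_if_all_gt:
  assumes "0 < N" "periodic N \<alpha>"
    and gt: "\<And>p. p < N \<Longrightarrow> \<exists>q. rotation_gt \<alpha> p \<beta> q"
  shows "\<not> is_rotation \<alpha> \<beta>"
proof
  assume "is_rotation \<alpha> \<beta>"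
  then obtain c where c: "\<And>k. \<beta> k = \<alpha> (k + c)" by (auto simp: is_rotation_def)
  obtain p where p: "p < N" "\<And>q. \<not> rotation_gt \<alpha> p \<alpha> q"
    using rotation_gt_not_total[OF assms(1,2)] by blast
  obtain q where "rotation_gt \<alpha> p \<beta> q" using gt p(1) by blast
  then have "rotation_gt \<alpha> p \<alpha> (q + c)"
    by (subst rotation_gt_cong[of \<alpha> p \<alpha> p \<alpha> "q + c" \<beta> q]) (auto simp: c algebra_simps)
  with p(2) show False by blast
qed

text \<open>Agreement on one full period extends to all positions. The offset \<open>i - j\<close>
  might be negative and is replaced by \<open>i + j * (N - 1)\<close>, which is congruent to it
  modulo \<open>N\<close>.\<close>

lemma is_rotation_if_match:
  assumes N: "0 < N" and per: "periodic N \<alpha>" "periodic N \<beta>"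
    and eq: "\<And>l. l < N \<Longrightarrow> \<alpha> (i + l) = \<beta> (j + l)"
  shows "is_rotation \<alpha> \<beta>"
proof -
  have all: "\<alpha> (i + l) = \<beta> (j + l)" for l
    using eq[of "l mod N"] N periodic_mod[OF per(1), of "i + l"]
      periodic_mod[OF per(1), of "i + l mod N"] periodic_mod[OF per(2), of "j + l"]
      periodic_mod[OF per(2), of "j + l mod N"]
    by (simp add: mod_add_right_eq)
  have "\<beta> k = \<alpha> (k + (i + j * (N - 1)))" for k
  proof -
    have "j + (k + j * (N - 1)) = k + j * N" using N by (cases N) (auto simp: algebra_simps)
    then have "\<beta> (j + (k + j * (N - 1))) = \<beta> k"
      using periodic_mod[OF per(2), of "k + j * N"] periodic_mod[OF per(2), of k]
      by (simp only: mod_mult_self1)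
    then show ?thesis using all[of "k + j * (N - 1)"] by (simp add: algebra_simps)
  qed
  then show ?thesis by (auto simp: is_rotation_def)
qed

text \<open>Invariant of the comparison: positions below \<open>i\<close> and \<open>j\<close> are
  discarded as starting points, each because its rotation exceeds some rotation of the other word,
  and \<open>k\<close> letters have been matched.\<close>

definition cyc_inv :: "(nat \<Rightarrow> nat) \<Rightarrow> (nat \<Rightarrow> nat) \<Rightarrow> nat \<Rightarrow> nat \<Rightarrow> nat \<Rightarrow> bool" where
  "cyc_inv \<alpha> \<beta> i j k \<longleftrightarrow>
     (\<forall>p<i. \<exists>q. rotation_gt \<alpha> p \<beta> q) \<and> (\<forall>q<j. \<exists>p. rotation_gt \<beta> q \<alpha> p) \<and>
     (\<forall>l<k. \<alpha> (i + l) = \<beta> (j + l))"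

lemma cyc_inv_swap: "cyc_inv \<alpha> \<beta> i j k \<longleftrightarrow> cyc_inv \<beta> \<alpha> j i k"
  by (auto simp: cyc_inv_def)

lemma cyc_inv_match:
  "cyc_inv \<alpha> \<beta> i j k \<Longrightarrow> \<alpha> (i + k) = \<beta> (j + k) \<Longrightarrow> cyc_inv \<alpha> \<beta> i j (Suc k)"
  by (auto simp: cyc_inv_def less_Suc_eq)

text \<open>
  A mismatch after \<open>k\<close> equal letters compares the rotations at \<open>i + m\<close> and \<open>j + m\<close> for all
  \<open>m \<le> k\<close> at once.
\<close>

lemma cyc_inv_gt:
  assumes "cyc_inv \<alpha> \<beta> i j k" "\<alpha> (i + k) > \<beta> (j + k)"
  shows "cyc_inv \<alpha> \<beta> (Suc (i + k)) j 0"
proof -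
  have "\<exists>q. rotation_gt \<alpha> p \<beta> q" if "p < Suc (i + k)" for p
  proof (cases "p < i")
    case True
    then show ?thesis using assms(1) by (auto simp: cyc_inv_def)
  next
    case False
    define m where "m = p - i"
    have m: "p = i + m" "m \<le> k" using False that by (auto simp: m_def)
    have "\<alpha> (p + l) = \<beta> (j + m + l)" if "l < k - m" for l
    proof -
      have "m + l < k" using that by simp
      then show ?thesis using assms(1) by (simp add: cyc_inv_def m(1) add.assoc)
    qed
    then have "rotation_gt \<alpha> p \<beta> (j + m)"
      unfolding rotation_gt_def by (intro exI[of _ "k - m"]) (use assms(2) m in auto)
    then show ?thesis ..
  qed
  then show ?thesis using assms(1) by (auto simp: cyc_inv_def)
qed

lemma cyc_inv_lt:
  "cyc_inv \<alpha> \<beta> i j k \<Longrightarrow> \<alpha> (i + k) < \<beta> (j + k) \<Longrightarrow> cyc_inv \<alpha> \<beta> i (Suc (j + k)) 0"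
  using cyc_inv_gt cyc_inv_swap by blast

text \<open>A match of full length proves equivalence. If instead all \<open>N\<close> rotations of
  one word are discarded, \<open>not_is_rotation_if_all_gt\<close> refutes it; for \<beta> this uses
  the symmetry of \<open>is_rotation\<close>.\<close>

lemma cyc_inv_final:
  assumes N: "0 < N" and per: "periodic N \<alpha>" "periodic N \<beta>"
    and inv: "cyc_inv \<alpha> \<beta> i j k" and final: "N \<le> i \<or> N \<le> j \<or> N \<le> k"
  shows "is_rotation \<alpha> \<beta> \<longleftrightarrow> N \<le> k"
proof
  assume "N \<le> k"
  with inv show "is_rotation \<alpha> \<beta>"
    by (intro is_rotation_if_match[OF N per, of i j]) (auto simp: cyc_inv_def)
next
  assume rot: "is_rotation \<alpha> \<beta>"
  show "N \<le> k"
  proof (rule ccontr)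
    assume "\<not> N \<le> k"
    with final consider "N \<le> i" | "N \<le> j" by auto
    then show False
    proof cases
      case 1
      with inv rot not_is_rotation_if_all_gt[OF N per(1), of \<beta>] show False
        by (auto simp: cyc_inv_def)
    next
      case 2
      with inv is_rotation_sym[OF N per(1) rot] not_is_rotation_if_all_gt[OF N per(2), of \<alpha>]
      show False by (auto simp: cyc_inv_def)
    qed
  qed
qed


section \<open>Conjugacy in the lamplighter group\<close>

text \<open>Keeps sums in the field \<open>bit\<close> from being rewritten to Boolean connectives.\<close>

declare add_bit_eq_xor [simp del] bit_not_zero_iff [simp del] bit_not_one_iff [simp del]

lemma bit_add_self [simp]: "b + b = 0" "b + (b + c) = c" for b c :: bit
  by (cases b; cases c; simp add: add_bit_eq_xor)+

lemma bit_add_eq_0_iff [simp]: "b + c = 0 \<longleftrightarrow> b = c" for b c :: bit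
  by (cases b; cases c; simp add: add_bit_eq_xor)

text \<open>
  With \<open>h\<close> the current height, a letter \<open>a\<close> toggles the lamp at \<open>h\<close>; lamps are identified modulo
  \<open>N\<close>, where \<open>N = 0\<close> identifies nothing because \<open>x mod 0 = x\<close>.
\<close>

primrec lamp :: "int \<Rightarrow> letter list \<Rightarrow> int \<Rightarrow> int \<Rightarrow> bit" where
  "lamp N [] h x = 0"
| "lamp N (l # w) h x = (case l of
     T_pos \<Rightarrow> lamp N w (h + 1) x
   | T_neg \<Rightarrow> lamp N w (h - 1) x
   | _ \<Rightarrow> of_bool (x mod N = h mod N) + lamp N w h x)"

abbreviation ups :: "letter list \<Rightarrow> nat" where "ups w \<equiv> count_list w T_pos"
abbreviation downs :: "letter list \<Rightarrow> nat" where "downs w \<equiv> count_list w T_neg"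

definition height :: "letter list \<Rightarrow> int" where
  "height w = int (ups w) - int (downs w)"

lemma lamp_shift: "lamp N w (h + b) (x + b) = lamp N w h x"
proof (induction w arbitrary: h)
  case (Cons l w)
  have "(x + b) mod N = (h + b) mod N \<longleftrightarrow> x mod N = h mod N"
    by (simp add: mod_eq_dvd_iff)
  moreover have "h + b + 1 = (h + 1) + b" "h + b - 1 = (h - 1) + b" by simp_all
  ultimately show ?case using Cons by (auto split: letter.split simp only: lamp.simps)
qed simp

lemma lamp_mod: "x mod N = y mod N \<Longrightarrow> lamp N w h x = lamp N w h y"
  by (induction w arbitrary: h) (auto split: letter.split)

text \<open>Only visited lamps can be lit, and a letter changes the height by at most one.\<close>

lemma lamp_0_nonzero:
  assumes "lamp 0 w h x \<noteq> 0"
  shows "\<bar>x - h\<bar> \<le> int (length w)"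
  using assms
proof (induction w arbitrary: h)
  case (Cons l w)
  then have "x = h \<or> lamp 0 w h x \<noteq> 0 \<or> lamp 0 w (h + 1) x \<noteq> 0 \<or> lamp 0 w (h - 1) x \<noteq> 0"
    by (cases l) auto
  then have "x = h \<or> \<bar>x - h\<bar> \<le> int (length w) \<or> \<bar>x - (h + 1)\<bar> \<le> int (length w)
      \<or> \<bar>x - (h - 1)\<bar> \<le> int (length w)"
    using Cons.IH by blast
  then show ?case by auto
qed simp

lemma finite_support_lamp: "finite {x. lamp 0 w h x \<noteq> 0}"
proof -
  have "{x. lamp 0 w h x \<noteq> 0} \<subseteq> {h - int (length w)..h + int (length w)}"
    using lamp_0_nonzero by (fastforce simp: abs_le_iff)
  then show ?thesis by (rule finite_subset) simp
qed

section \<open>Words as group elements\<close>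

lemma mult_lamplighter:
  "(d, f) \<otimes>\<^bsub>lamplighter\<^esub> (d', f') = (d + d', \<lambda>x. f (x + d') + f' x)"
  by (simp add: lamplighter_def shift_def)

lemma carrier_lamplighter: "(d, f) \<in> carrier lamplighter \<longleftrightarrow> finite {x. f x \<noteq> 0}"
  by (simp add: lamplighter_def)

lemma inv_lamplighter:
  assumes "finite {x. f x \<noteq> 0}"
  shows "inv\<^bsub>lamplighter\<^esub> (d, f) = (- d, shift (- d) f)"
proof -
  interpret group lamplighter by (rule group_lamplighter)
  show ?thesis
  proof (rule inv_equality)
    show "(- d, shift (- d) f) \<otimes>\<^bsub>lamplighter\<^esub> (d, f) = \<one>\<^bsub>lamplighter\<^esub>"
      by (simp add: mult_lamplighter) (simp add: lamplighter_def shift_def)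
  qed (use assms finite_support_shift in \<open>simp_all add: carrier_lamplighter\<close>)
qed

text \<open>In a product the earlier factor is shifted by the height of the later one. A letter
  \<open>a\<close> read at height \<open>h\<close> therefore ends up at \<open>h - height w\<close>,
  which the shifted argument of \<open>lamp\<close> accounts for.\<close>

lemma word_val_eq: "word_val w = (height w, \<lambda>x. lamp 0 w 0 (x + height w))"
proof (induction w)
  case Nil
  then show ?case by (simp add: word_val_def lamplighter_def height_def)
next
  case (Cons l w)
  have "word_val (l # w) = letter_val l \<otimes>\<^bsub>lamplighter\<^esub> word_val w"
    by (simp add: word_val_def)
  \<comment> \<open>A leading \<open>t\<close> raises both the starting height of \<open>w\<close>
    and the total height by one, and these shifts cancel; the next fact is the same for the inverse
    letter.\<close>
  moreover have "lamp 0 w 1 (x + 1 + height w) = lamp 0 w 0 (x + height w)" for x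
    using lamp_shift[of 0 w 0 1 "x + height w"] by (simp add: algebra_simps)
  moreover have "lamp 0 w (-1) (x - 1 + height w) = lamp 0 w 0 (x + height w)" for x
    using lamp_shift[of 0 w 0 "-1" "x + height w"] by (simp add: algebra_simps)
  ultimately show ?case
    by (cases l)
      (auto simp: Cons gen_a_def gen_t_def inv_lamplighter mult_lamplighter shift_def height_def
         fun_eq_iff algebra_simps)
qed

lemma conjugate_lamplighter_iff:
  assumes "finite {x. f x \<noteq> 0}" "finite {x. f' x \<noteq> 0}"
  shows "conjugate_in lamplighter (d, f) (d', f') \<longleftrightarrow> d = d' \<and>
    (\<exists>c h. finite {x. h x \<noteq> 0} \<and> (\<forall>x. f' x = f (x + c) + h (x + d) + h x))"
proof -
  have "inv\<^bsub>lamplighter\<^esub> (c, h) \<otimes>\<^bsub>lamplighter\<^esub> (d, f) \<otimes>\<^bsub>lamplighter\<^esub> (c, h) =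
      (d, \<lambda>x. f (x + c) + h (x + d) + h x)" if "finite {x. h x \<noteq> 0}" for c h
    using that by (simp add: inv_lamplighter mult_lamplighter shift_def fun_eq_iff algebra_simps)
  moreover have "conjugate_in lamplighter (d, f) (d', f') \<longleftrightarrow> (\<exists>c h. finite {x. h x \<noteq> 0} \<and>
      (d', f') = inv\<^bsub>lamplighter\<^esub> (c, h) \<otimes>\<^bsub>lamplighter\<^esub> (d, f) \<otimes>\<^bsub>lamplighter\<^esub> (c, h))"
    by (simp only: conjugate_in_def Bex_def split_paired_Ex carrier_lamplighter)
  ultimately have "conjugate_in lamplighter (d, f) (d', f') \<longleftrightarrow>
      (\<exists>c h. finite {x. h x \<noteq> 0} \<and> (d', f') = (d, \<lambda>x. f (x + c) + h (x + d) + h x))"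
    by (simp cong: conj_cong)
  then show ?thesis by (auto simp: fun_eq_iff)
qed

section \<open>Folding finitely supported functions modulo \<open>N\<close>\<close>

definition fold_mod :: "int \<Rightarrow> (int \<Rightarrow> bit) \<Rightarrow> int \<Rightarrow> bit" where
  "fold_mod N f r = (\<Sum>x | f x \<noteq> 0 \<and> x mod N = r mod N. f x)"

text \<open>\<open>fold_mod\<close> sums over the support because a residue class may be infinite.
  Any finite \<open>S\<close> containing the support points of the class serves as well, which gives
  several functions a common index set.\<close>

lemma fold_mod_eq_sum:
  assumes "finite S" "\<And>x. f x \<noteq> 0 \<Longrightarrow> x mod N = r mod N \<Longrightarrow> x \<in> S"
  shows "fold_mod N f r = (\<Sum>x | x \<in> S \<and> x mod N = r mod N. f x)"
  unfolding fold_mod_def by (rule sum.mono_neutral_left) (use assms in auto)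

lemma fold_mod_add:
  assumes "finite {x. f x \<noteq> 0}" "finite {x. g x \<noteq> 0}"
  shows "fold_mod N (\<lambda>x. f x + g x) r = fold_mod N f r + fold_mod N g r"
proof -
  let ?S = "{x. f x \<noteq> 0} \<union> {x. g x \<noteq> 0}"
  have "finite ?S" using assms by simp
  then show ?thesis
    by (subst (1 2 3) fold_mod_eq_sum[of ?S]) (auto simp: sum.distrib)
qed

lemma fold_mod_shift: "fold_mod N (\<lambda>x. f (x + c)) r = fold_mod N f (r + c)"
  unfolding fold_mod_def
proof (rule sum.reindex_bij_witness[of _ "\<lambda>x. x - c" "\<lambda>x. x + c"])
  fix x assume "x \<in> {x. f (x + c) \<noteq> 0 \<and> x mod N = r mod N}"
  then show "x + c \<in> {x. f x \<noteq> 0 \<and> x mod N = (r + c) mod N}" by (auto intro: mod_add_cong)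
next
  fix x assume "x \<in> {x. f x \<noteq> 0 \<and> x mod N = (r + c) mod N}"
  then have "f x \<noteq> 0" "(x - c) mod N = (r + c - c) mod N"
    using mod_diff_cong[of x N "r + c" c c] by blast+
  then show "x - c \<in> {x. f (x + c) \<noteq> 0 \<and> x mod N = r mod N}" by simp
qed auto

lemma fold_mod_cong: "r mod N = s mod N \<Longrightarrow> fold_mod N f r = fold_mod N f s"
  by (simp add: fold_mod_def)

text \<open>Folding commutes with reading a word, so the machine may toggle lamps directly in a
  cyclic track of \<open>N\<close> cells.\<close>

lemma fold_mod_lamp: "fold_mod N (lamp 0 w h) r = lamp N w h r"
proof (induction w arbitrary: h)
  case Nil
  then show ?case by (simp add: fold_mod_def)
next
  case (Cons l w)
  have "{x. (of_bool (x = h) :: bit) \<noteq> 0} = {h}" by auto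
  moreover have "fold_mod N (\<lambda>x. of_bool (x = h)) r = of_bool (r mod N = h mod N)"
    by (subst fold_mod_eq_sum[of "{h}"]) (auto simp: conj_commute sum.If_cases cong: conj_cong)
  ultimately show ?case
    using Cons fold_mod_add[OF _ finite_support_lamp, where f = "\<lambda>x. of_bool (x = h)"]
    by (auto split: letter.split)
qed

text \<open>The sum \<open>h x\<close> of \<open>k\<close> over the points of the residue class
  strictly below \<open>x\<close> telescopes: it grows by \<open>k x\<close> from \<open>x\<close>
  to \<open>x + N\<close>. It vanishes left of the support of \<open>k\<close>, and also right of it
  because the sum over the whole class is zero.\<close>

lemma coboundary_pos:
  fixes k :: "int \<Rightarrow> bit"
  assumes N: "0 < N" and fin: "finite {x. k x \<noteq> 0}" and fold: "\<And>r. fold_mod N k r = 0"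
  shows "\<exists>h. finite {x. h x \<noteq> 0} \<and> (\<forall>x. k x = h (x + N) + h x)"
proof -
  define A where "A x = {y. k y \<noteq> 0 \<and> y mod N = x mod N \<and> y < x}" for x
  define h where "h x = (\<Sum>y\<in>A x. k y)" for x
  have finA: "finite (A x)" for x
    by (rule finite_subset[OF _ fin]) (auto simp: A_def)
  have "k x = h (x + N) + h x" for x
  proof -
    \<comment> \<open>From \<open>x\<close> up to but excluding \<open>x + N\<close>, the class
      contains \<open>x\<close> alone, so \<open>A (x + N)\<close> gains at most this point over
      \<open>A x\<close>.\<close>
    have gap: "y = x" if "y mod N = x mod N" "x \<le> y" "y < x + N" for y
    proof -
      have "N dvd y - x" using that(1) by (simp add: mod_eq_dvd_iff)
      with that(2,3) show ?thesis using zdvd_not_zless[of "y - x" N] by force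
    qed
    have "A (x + N) = A x \<union> (if k x = 0 then {} else {x})"
      using gap N by (fastforce simp: A_def split: if_splits)
    moreover have "x \<notin> A x" by (simp add: A_def)
    ultimately have "h (x + N) = h x + k x"
      using finA by (simp add: h_def)
    then show ?thesis by (simp add: add.commute add.left_commute)
  qed
  moreover obtain b where b: "\<And>x. k x \<noteq> 0 \<Longrightarrow> \<bar>x\<bar> \<le> b"
    using fin by (metis (mono_tags, lifting) finite_imageI mem_Collect_eq image_eqI Max_ge)
  have "{x. h x \<noteq> 0} \<subseteq> {- b..b}"
  proof
    fix x assume "x \<in> {x. h x \<noteq> 0}"
    then have hx: "h x \<noteq> 0" by simp
    then have "A x \<noteq> {}" by (auto simp: h_def)
    then have "- b \<le> x" using b by (fastforce simp: A_def)
    moreover have "x \<le> b"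
    proof (rule ccontr)
      assume "\<not> x \<le> b"
      then have "A x = {y. k y \<noteq> 0 \<and> y mod N = x mod N}" using b by (fastforce simp: A_def)
      then have "h x = fold_mod N k x" by (simp add: h_def fold_mod_def)
      with fold hx show False by simp
    qed
    ultimately show "x \<in> {- b..b}" by simp
  qed
  then have "finite {x. h x \<noteq> 0}" by (rule finite_subset) simp
  ultimately show ?thesis by blast
qed

text \<open>A shift by \<open>d\<close> preserves residues modulo \<open>\<bar>d\<bar>\<close>, so
  \<open>h (x + d)\<close> and \<open>h x\<close> fold to the same value and cancel in
  characteristic two. The converse is \<open>coboundary_pos\<close>.\<close>

lemma coboundary_iff:
  fixes k :: "int \<Rightarrow> bit"
  assumes d: "d \<noteq> 0" and fin: "finite {x. k x \<noteq> 0}"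
  shows "(\<exists>h. finite {x. h x \<noteq> 0} \<and> (\<forall>x. k x = h (x + d) + h x)) \<longleftrightarrow>
    (\<forall>r. fold_mod \<bar>d\<bar> k r = 0)"
proof
  assume "\<exists>h. finite {x. h x \<noteq> 0} \<and> (\<forall>x. k x = h (x + d) + h x)"
  then obtain h where h: "finite {x. h x \<noteq> 0}" "\<And>x. k x = h (x + d) + h x" by blast
  have "k = (\<lambda>x. h (x + d) + h x)" using h(2) by auto
  then have "fold_mod \<bar>d\<bar> k r = fold_mod \<bar>d\<bar> h (r + d) + fold_mod \<bar>d\<bar> h r" for r
    using fold_mod_add[OF finite_support_shift[OF h(1), of d, unfolded shift_def] h(1)]
    by (simp add: fold_mod_shift)
  moreover have "fold_mod \<bar>d\<bar> h (r + d) = fold_mod \<bar>d\<bar> h r" for r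
    by (rule fold_mod_cong) (simp add: mod_eq_dvd_iff)
  ultimately show "\<forall>r. fold_mod \<bar>d\<bar> k r = 0" by simp
next
  assume "\<forall>r. fold_mod \<bar>d\<bar> k r = 0"
  then obtain h where h: "finite {x. h x \<noteq> 0}" "\<And>x. k x = h (x + \<bar>d\<bar>) + h x"
    using coboundary_pos[of "\<bar>d\<bar>" k] d fin by auto
  show "\<exists>h. finite {x. h x \<noteq> 0} \<and> (\<forall>x. k x = h (x + d) + h x)"
  proof (cases "d < 0")
    case True
    \<comment> \<open>For negative \<open>d\<close> the step is \<open>- d\<close>; shifting
      \<open>h\<close> by it gives a witness for \<open>d\<close> itself.\<close>
    have "k x = h (x + d - d) + h (x - d)" for x
      using h(2)[of x] True by (simp add: add.commute)
    with finite_support_shift[OF h(1), of "- d", unfolded shift_def] show ?thesis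
      by (intro exI[of _ "\<lambda>x. h (x - d)"]) auto
  next
    case False
    with h show ?thesis by (intro exI[of _ h]) auto
  qed
qed

text \<open>If \<open>\<bar>x\<bar> \<le> 3 * n\<close>, a support point congruent to
  \<open>x\<close> is at distance at most \<open>4 * n < N\<close>, hence equal to \<open>x\<close>,
  so folding loses nothing in this window. Given a rotation \<open>c\<close>, a lit point of
  \<open>f'\<close> and a matching one of \<open>f\<close> yield an offset \<open>e\<close>
  congruent to \<open>c\<close> with \<open>\<bar>e\<bar> \<le> 2 * n\<close>, which keeps all
  relevant arguments in the window.\<close>

lemma shift_eq_iff_fold_mod:
  fixes f f' :: "int \<Rightarrow> bit"
  assumes f: "\<And>x. f x \<noteq> 0 \<Longrightarrow> \<bar>x\<bar> \<le> n" and f': "\<And>x. f' x \<noteq> 0 \<Longrightarrow> \<bar>x\<bar> \<le> n"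
    and N: "4 * n < N"
  shows "(\<exists>c. \<forall>x. f' x = f (x + c)) \<longleftrightarrow>
    (\<exists>c. \<forall>r. fold_mod N f' r = fold_mod N f (r + c))"
proof
  assume "\<exists>c. \<forall>x. f' x = f (x + c)"
  then obtain c where "f' = (\<lambda>x. f (x + c))" by auto
  then show "\<exists>c. \<forall>r. fold_mod N f' r = fold_mod N f (r + c)"
    by (metis fold_mod_shift)
next
  have fold: "fold_mod N g x = g x" if g: "\<And>x. g x \<noteq> 0 \<Longrightarrow> \<bar>x\<bar> \<le> n" and x: "\<bar>x\<bar> \<le> 3 * n" for g x
  proof -
    have "y = x" if "g y \<noteq> 0" "y mod N = x mod N" for y
    proof -
      have "N dvd \<bar>y - x\<bar>" using that(2) by (simp add: mod_eq_dvd_iff)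
      moreover have "\<bar>y - x\<bar> < N" using g[OF that(1)] x N by linarith
      ultimately show ?thesis using zdvd_not_zless[of "\<bar>y - x\<bar>" N] by force
    qed
    then have "fold_mod N g x = (\<Sum>y | y \<in> {x} \<and> y mod N = x mod N. g y)"
      by (intro fold_mod_eq_sum) auto
    also have "{y. y \<in> {x} \<and> y mod N = x mod N} = {x}" by auto
    finally show ?thesis by simp
  qed
  have fold_f: "fold_mod N f x = f x" and fold_f': "fold_mod N f' x = f' x" if "\<bar>x\<bar> \<le> 3 * n" for x
    using that f f' by (blast intro: fold)+
  assume "\<exists>c. \<forall>r. fold_mod N f' r = fold_mod N f (r + c)"
  then obtain c where c: "\<And>r. fold_mod N f' r = fold_mod N f (r + c)" by blast
  show "\<exists>c. \<forall>x. f' x = f (x + c)"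
  proof (cases "\<exists>s. f' s \<noteq> 0")
    case True
    then obtain s where s: "f' s \<noteq> 0" by blast
    then have "fold_mod N f (s + c) \<noteq> 0"
      using c[of s] fold_f'[of s] f'[OF s] by auto
    then obtain t where t: "f t \<noteq> 0" "t mod N = (s + c) mod N"
      unfolding fold_mod_def by (auto elim: sum.not_neutral_contains_not_neutral)
    define e where "e = t - s"
    have e: "\<bar>e\<bar> \<le> 2 * n" using f[OF t(1)] f'[OF s] by (auto simp: e_def)
    have "(r + c) mod N = (r + e) mod N" for r
      using t(2) by (auto simp: e_def mod_eq_dvd_iff dvd_diff_commute algebra_simps)
    then have eq: "fold_mod N f' r = fold_mod N f (r + e)" for r
      using c[of r] fold_mod_cong by metis
    have "f' x = f (x + e)" for x
    proof (cases "f' x \<noteq> 0 \<or> f (x + e) \<noteq> 0")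
      case True
      then have "\<bar>x\<bar> \<le> 3 * n" "\<bar>x + e\<bar> \<le> 3 * n"
        using f'[of x] f[of "x + e"] e by linarith+
      then show ?thesis using eq[of x] fold_f'[of x] fold_f[of "x + e"] by simp
    qed auto
    then show ?thesis by blast
  next
    case False
    \<comment> \<open>Without a lit point in \<open>f'\<close>, the folded \<open>f\<close> vanishes
      as well, hence so does \<open>f\<close>, and any offset works.\<close>
    then have "fold_mod N f' r = 0" for r by (simp add: fold_mod_def)
    then have "fold_mod N f r = 0" for r using c[of "r - c"] by simp
    then have "f x = 0" for x using f[of x] fold_f[of x] by fastforce
    with False show ?thesis by auto
  qed
qed

text \<open>At height \<open>0\<close> the two terms with \<open>h\<close> cancel and translates
  remain, which \<open>shift_eq_iff_fold_mod\<close> handles; otherwise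
  \<open>coboundary_iff\<close> applies. Both cases lead to the same test on folded words.\<close>

lemma conjugate_word_val_iff:
  assumes d: "height u \<noteq> 0 \<Longrightarrow> N = \<bar>height u\<bar>"
    and 0: "height u = 0 \<Longrightarrow> 4 * int (length u + length v) < N"
  shows "conjugate_in lamplighter (word_val u) (word_val v) \<longleftrightarrow>
    height u = height v \<and> (\<exists>c. \<forall>r. lamp N v 0 r = lamp N u 0 (r + c))"
proof (cases "height u = height v")
  case True
  define d where "d = height u"
  define f where "f = lamp 0 u 0"
  define g where "g = lamp 0 v 0"
  have fin: "finite {x. f x \<noteq> 0}" "finite {x. g x \<noteq> 0}"
    by (simp_all add: f_def g_def finite_support_lamp)
  have fins: "finite {x. f (x + c) \<noteq> 0}" "finite {x. g (x + c) \<noteq> 0}" for c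
    using finite_support_shift[OF fin(1)] finite_support_shift[OF fin(2)] by (simp_all add: shift_def)
  have 1: "conjugate_in lamplighter (word_val u) (word_val v) \<longleftrightarrow>
     (\<exists>c h. finite {x. h x \<noteq> 0} \<and> (\<forall>x. g (x + d) = f (x + c + d) + h (x + d) + h x))"
    using conjugate_lamplighter_iff[OF fins, of d d d d] True
    by (simp add: word_val_eq d_def f_def g_def)
  \<comment> \<open>The common shift by \<open>d\<close> that \<open>word_val_eq\<close> puts on
    both lamp functions is removed by substituting \<open>x - d\<close> and shifting
    \<open>h\<close>.\<close>
  have 2: "\<dots> \<longleftrightarrow> (\<exists>c h. finite {x. h x \<noteq> 0} \<and> (\<forall>x. g x = f (x + c) + h (x + d) + h x))"
    (is "(\<exists>c h. ?P c h) \<longleftrightarrow> (\<exists>c h. ?Q c h)")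
  proof -
    have "?Q c (shift (- d) h)" if "?P c h" for c h
    proof -
      have "g x = f (x + c) + shift (- d) h (x + d) + shift (- d) h x" for x
        using that[THEN conjunct2, rule_format, of "x - d"] by (simp add: shift_def algebra_simps)
      with that finite_support_shift show ?thesis by blast
    qed
    moreover have "?P c (shift d h)" if "?Q c h" for c h
    proof -
      have "g (x + d) = f (x + c + d) + shift d h (x + d) + shift d h x" for x
        using that[THEN conjunct2, rule_format, of "x + d"] by (simp add: shift_def algebra_simps)
      with that finite_support_shift show ?thesis by blast
    qed
    ultimately show ?thesis by blast
  qed
  have 3: "\<dots> \<longleftrightarrow> (\<exists>c. \<forall>r. fold_mod N g r = fold_mod N f (r + c))"
  proof (cases "d = 0")
    case True
    then have "(\<exists>c h. ?Q c h) \<longleftrightarrow> (\<exists>c. \<forall>x. g x = f (x + c))"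
      by (auto simp: add.assoc intro: exI[of _ "\<lambda>_. 0"])
    also have "\<dots> \<longleftrightarrow> (\<exists>c. \<forall>r. fold_mod N g r = fold_mod N f (r + c))"
    proof (rule shift_eq_iff_fold_mod)
      show "\<bar>x\<bar> \<le> int (length u + length v)" if "f x \<noteq> 0" for x
        using lamp_0_nonzero[of u 0 x] that by (auto simp: f_def)
      show "\<bar>x\<bar> \<le> int (length u + length v)" if "g x \<noteq> 0" for x
        using lamp_0_nonzero[of v 0 x] that by (auto simp: g_def)
    qed (use 0 True in \<open>simp add: d_def\<close>)
    finally show ?thesis .
  next
    case False
    then have N: "N = \<bar>d\<bar>" using d by (simp add: d_def)
    have "(\<exists>h. ?Q c h) \<longleftrightarrow> (\<forall>r. fold_mod N g r = fold_mod N f (r + c))" for c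
    proof -
      \<comment> \<open>Moving a term across the equation needs no sign here, so
        \<open>g x + f (x + c)\<close> is the function to be written as a coboundary.\<close>
      have move: "a = b + p + q \<longleftrightarrow> a + b = p + q" for a b p q :: bit
        by (cases a; cases b; cases p; cases q) (simp_all add: add_bit_eq_xor)
      have "(\<exists>h. ?Q c h) \<longleftrightarrow> (\<exists>h. finite {x. h x \<noteq> 0} \<and> (\<forall>x. g x + f (x + c) = h (x + d) + h x))"
        by (simp only: move)
      also have "\<dots> \<longleftrightarrow> (\<forall>r. fold_mod N (\<lambda>x. g x + f (x + c)) r = 0)"
        unfolding N by (rule coboundary_iff[OF False finite_support_add[OF fin(2) fins(1)]])
      also have "\<dots> \<longleftrightarrow> (\<forall>r. fold_mod N g r = fold_mod N f (r + c))"
        by (simp add: fold_mod_add[OF fin(2) fins(1)] fold_mod_shift)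
      finally show ?thesis .
    qed
    then show ?thesis by blast
  qed
  show ?thesis unfolding 1 2 3 using True by (simp add: f_def g_def fold_mod_lamp)
next
  case False
  then show ?thesis
    using conjugate_lamplighter_iff[OF finite_support_shift finite_support_shift,
        OF finite_support_lamp finite_support_lamp]
    by (simp add: word_val_eq shift_def)
qed

section \<open>Folded words as sequences of numbers\<close>

definition track :: "nat \<Rightarrow> letter list \<Rightarrow> nat \<Rightarrow> nat" where
  "track N w r = of_bool (lamp (int N) w 0 (int r) = 1)"

lemma periodic_track: "periodic N (track N w)"
proof -
  have "lamp (int N) w 0 (int k + int N) = lamp (int N) w 0 (int k)" for k
    by (rule lamp_mod) simp
  then show ?thesis by (simp add: periodic_def track_def)
qed

text \<open>Positions and offsets matter only modulo \<open>N\<close>, so negative ones can be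
  reduced to natural numbers.\<close>

lemma is_rotation_track_iff:
  assumes "0 < N"
  shows "is_rotation (track N u) (track N v) \<longleftrightarrow>
    (\<exists>c. \<forall>r. lamp (int N) v 0 r = lamp (int N) u 0 (r + c))"
proof
  assume "is_rotation (track N u) (track N v)"
  then obtain c where c: "\<And>k. track N v k = track N u (k + c)" by (auto simp: is_rotation_def)
  have "lamp (int N) v 0 r = lamp (int N) u 0 (r + int c)" for r
  proof -
    have "lamp (int N) v 0 (int k) = lamp (int N) u 0 (int k + int c)" for k
    proof -
      have "a = b" if "(a = 1) = (b = 1)" for a b :: bit using that by (cases a; cases b) simp_all
      with c[of k] show ?thesis by (simp add: track_def of_bool_eq_iff)
    qed
    from this[of "nat (r mod N)"] assms
    have "lamp (int N) v 0 (r mod N) = lamp (int N) u 0 (r mod N + int c)" by simp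
    moreover have "lamp (int N) v 0 (r mod N) = lamp (int N) v 0 r"
      "lamp (int N) u 0 (r mod N + int c) = lamp (int N) u 0 (r + int c)"
      by (rule lamp_mod, simp add: mod_add_left_eq)+
    ultimately show ?thesis by simp
  qed
  then show "\<exists>c. \<forall>r. lamp (int N) v 0 r = lamp (int N) u 0 (r + c)" by blast
next
  assume "\<exists>c. \<forall>r. lamp (int N) v 0 r = lamp (int N) u 0 (r + c)"
  then obtain c where c: "\<And>r. lamp (int N) v 0 r = lamp (int N) u 0 (r + c)" by blast
  have "track N v k = track N u (k + nat (c mod N))" for k
  proof -
    have "lamp (int N) u 0 (int k + c) = lamp (int N) u 0 (int (k + nat (c mod N)))"
      by (rule lamp_mod) (use assms in \<open>simp add: mod_add_right_eq\<close>)
    with c[of "int k"] show ?thesis by (simp add: track_def)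
  qed
  then show "is_rotation (track N u) (track N v)" by (auto simp: is_rotation_def)
qed


section \<open>The program\<close>

text \<open>
  Registers \<open>0\<close> and \<open>1\<close> stay unused: the simplifier rewrites \<open>1\<close> to \<open>Suc 0\<close>, whereas register
  numbers should remain numerals.
\<close>

abbreviation (input) cur :: nat where "cur \<equiv> 2"
abbreviation (input) ptr :: nat where "ptr \<equiv> 3"
abbreviation (input) up1 :: nat where "up1 \<equiv> 4"
abbreviation (input) down1 :: nat where "down1 \<equiv> 5"
abbreviation (input) up2 :: nat where "up2 \<equiv> 6"
abbreviation (input) down2 :: nat where "down2 \<equiv> 7"
abbreviation (input) tmp :: nat where "tmp \<equiv> 8"
abbreviation (input) modulus :: nat where "modulus \<equiv> 9"
abbreviation (input) lo :: nat where "lo \<equiv> 10"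
abbreviation (input) hi :: nat where "hi \<equiv> 11"
abbreviation (input) pos :: nat where "pos \<equiv> 12"
abbreviation (input) idx1 :: nat where "idx1 \<equiv> 13"
abbreviation (input) idx2 :: nat where "idx2 \<equiv> 14"
abbreviation (input) matched :: nat where "matched \<equiv> 15"
abbreviation (input) val1 :: nat where "val1 \<equiv> 16"
abbreviation (input) val2 :: nat where "val2 \<equiv> 17"
abbreviation (input) ans :: nat where "ans \<equiv> 18"
abbreviation (input) ip :: nat where "ip \<equiv> 19"
abbreviation (input) heap :: nat where "heap \<equiv> 20"

text \<open>The two words are first copied to the heap, because the modulus depends on all of the input.\<close>

definition read_body :: "nat \<Rightarrow> nat \<Rightarrow> com" where
  "read_body up down =
     Basic (Store ptr (Reg cur)) ;;
     Basic (Add ptr (Imm 1)) ;;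
     Basic (Assign tmp (Reg cur)) ;;
     Basic (Sub tmp (Imm 2)) ;;
     IfZero tmp Skip
      (Basic (Sub tmp (Imm 1)) ;;
       IfZero tmp (Basic (Add up (Imm 1))) (Basic (Add down (Imm 1)))) ;;
     Basic (Read cur)"

text \<open>The terminating zero is stored too; it later stops the loop of
  \<open>fold_word\<close>.\<close>

definition read_word :: "nat \<Rightarrow> nat \<Rightarrow> com" where
  "read_word up down =
     Basic (Read cur) ;;
     While cur (read_body up down) ;;
     Basic (Store ptr (Reg cur)) ;;
     Basic (Add ptr (Imm 1))"

text \<open>Comparing \<open>up1 + down2\<close> with \<open>up2 + down1\<close> avoids negative
  heights. One of the two truncated differences is always zero, so their sum in \<open>val2\<close>
  is the absolute difference.\<close>

definition height_difference :: com where
  "height_difference =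
     Basic (Assign tmp (Reg up1)) ;;
     Basic (Add tmp (Reg down2)) ;;
     Basic (Assign val1 (Reg up2)) ;;
     Basic (Add val1 (Reg down1)) ;;
     Basic (Assign val2 (Reg tmp)) ;;
     Basic (Sub val2 (Reg val1)) ;;
     Basic (Sub val1 (Reg tmp)) ;;
     Basic (Add val2 (Reg val1))"

text \<open>
  After the input has been read, \<open>ptr\<close> exceeds the number of letters, so \<open>4 * ptr\<close> is large enough
  for elements of height \<open>0\<close>.
\<close>

definition set_modulus :: com where
  "set_modulus =
     Basic (Assign modulus (Reg up1)) ;;
     Basic (Sub modulus (Reg down1)) ;;
     Basic (Assign tmp (Reg down1)) ;;
     Basic (Sub tmp (Reg up1)) ;;
     Basic (Add modulus (Reg tmp)) ;;
     IfZero modulus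
      (Basic (Assign modulus (Reg ptr)) ;;
       Basic (Add modulus (Reg modulus)) ;;
       Basic (Add modulus (Reg modulus)))
      Skip"

text \<open>\<open>pos\<close> is the address of the current lamp in the track that occupies \<open>{lo..<hi}\<close>.\<close>

definition fold_body :: com where
  "fold_body =
     Basic (Assign tmp (Reg cur)) ;;
     Basic (Sub tmp (Imm 2)) ;;
     IfZero tmp
      (Basic (Assign val1 (Imm 1)) ;;
       Basic (Sub val1 (Ind pos)) ;;
       Basic (Store pos (Reg val1)))
      (Basic (Sub tmp (Imm 1)) ;;
       IfZero tmp
        (Basic (Add pos (Imm 1)) ;;
         Basic (Assign val1 (Reg hi)) ;;
         Basic (Sub val1 (Reg pos)) ;;
         IfZero val1 (Basic (Assign pos (Reg lo))) Skip)
        (Basic (Assign val1 (Reg pos)) ;;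
         Basic (Sub val1 (Reg lo)) ;;
         IfZero val1 (Basic (Assign pos (Reg hi))) Skip ;;
         Basic (Sub pos (Imm 1)))) ;;
     Basic (Assign cur (Ind ip)) ;;
     Basic (Add ip (Imm 1))"

definition fold_word :: com where
  "fold_word =
     Basic (Assign hi (Reg lo)) ;;
     Basic (Add hi (Reg modulus)) ;;
     Basic (Assign pos (Reg lo)) ;;
     Basic (Assign cur (Ind ip)) ;;
     Basic (Add ip (Imm 1)) ;;
     While cur fold_body"

text \<open>\<open>tmp\<close> becomes zero exactly if the sum of \<open>idx\<close> and
  \<open>matched\<close> is below the modulus. Otherwise a single subtraction reduces it, provided
  both summands are below the modulus.\<close>

definition fetch :: "nat \<Rightarrow> nat \<Rightarrow> nat \<Rightarrow> com" where
  "fetch dst base idx =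
     Basic (Assign dst (Reg idx)) ;;
     Basic (Add dst (Reg matched)) ;;
     Basic (Assign tmp (Reg dst)) ;;
     Basic (Add tmp (Imm 1)) ;;
     Basic (Sub tmp (Reg modulus)) ;;
     IfZero tmp Skip (Basic (Sub dst (Reg modulus))) ;;
     Basic (Add dst (Reg base)) ;;
     Basic (Assign dst (Ind dst))"

definition test_indices :: com where
  "test_indices =
     Basic (Assign cur (Reg modulus)) ;;
     Basic (Sub cur (Reg idx1)) ;;
     IfZero cur Skip
      (Basic (Assign cur (Reg modulus)) ;;
       Basic (Sub cur (Reg idx2)) ;;
       IfZero cur Skip
        (Basic (Assign cur (Reg modulus)) ;;
         Basic (Sub cur (Reg matched))))"

definition skip_rotations :: "nat \<Rightarrow> com" where
  "skip_rotations idx =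
     Basic (Add idx (Reg matched)) ;;
     Basic (Add idx (Imm 1)) ;;
     Basic (Assign matched (Imm 0))"

definition advance :: com where
  "advance =
     Basic (Assign tmp (Reg val1)) ;;
     Basic (Sub tmp (Reg val2)) ;;
     IfZero tmp
      (Basic (Sub val2 (Reg val1)) ;;
       IfZero val2 (Basic (Add matched (Imm 1))) (skip_rotations idx2))
      (skip_rotations idx1)"

text \<open>After \<open>fold_words\<close> the first track begins at \<open>ptr\<close> and the
  second at \<open>lo\<close>.\<close>

definition compare_body :: com where
  "compare_body = fetch val1 ptr idx1 ;; fetch val2 lo idx2 ;; advance ;; test_indices"

text \<open>The truncated value \<open>matched + 1 - modulus\<close> is nonzero exactly if a full
  period has matched.\<close>

definition compare_tracks :: com where
  "compare_tracks =
     Basic (Assign idx1 (Imm 0)) ;;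
     Basic (Assign idx2 (Imm 0)) ;;
     Basic (Assign matched (Imm 0)) ;;
     test_indices ;;
     While cur compare_body ;;
     Basic (Assign ans (Reg matched)) ;;
     Basic (Add ans (Imm 1)) ;;
     Basic (Sub ans (Reg modulus))"

definition fold_words :: com where
  "fold_words =
     Basic (Assign ip (Imm heap)) ;;
     Basic (Assign lo (Reg ptr)) ;;
     fold_word ;;
     Basic (Assign lo (Reg hi)) ;;
     fold_word"

definition conjugacy_com :: com where
  "conjugacy_com =
     Basic (Assign ptr (Imm heap)) ;;
     read_word up1 down1 ;;
     read_word up2 down2 ;;
     height_difference ;;
     IfZero val2 (set_modulus ;; fold_words ;; compare_tracks) Skip"


section \<open>Correctness and running time\<close>

primrec holds :: "(nat \<Rightarrow> nat) \<Rightarrow> nat \<Rightarrow> letter list \<Rightarrow> bool" where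
  "holds R a [] \<longleftrightarrow> True"
| "holds R a (l # w) \<longleftrightarrow> R a = letter_code l \<and> holds R (Suc a) w"

definition stored :: "(nat \<Rightarrow> nat) \<Rightarrow> nat \<Rightarrow> letter list \<Rightarrow> bool" where
  "stored R a w \<longleftrightarrow> holds R a w \<and> R (a + length w) = 0"

lemma holds_cong:
  "(\<And>i. a \<le> i \<Longrightarrow> i < a + length w \<Longrightarrow> R i = R' i) \<Longrightarrow> holds R a w \<longleftrightarrow> holds R' a w"
  by (induction w arbitrary: a) auto

lemma stored_cong:
  "(\<And>i. a \<le> i \<Longrightarrow> i \<le> a + length w \<Longrightarrow> R i = R' i) \<Longrightarrow> stored R a w \<longleftrightarrow> stored R' a w"
  unfolding stored_def by (intro conj_cong holds_cong) auto

lemma stored_Cons: "stored R a (l # w) \<longleftrightarrow> R a = letter_code l \<and> stored R (Suc a) w"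
  by (auto simp: stored_def)

lemma ups_plus_downs_le: "ups w + downs w \<le> length w"
  by (induction w) auto

text \<open>On entry the first symbol is already in \<open>cur\<close>; taking \<open>hd\<close> and
  \<open>tl\<close> of the word with its terminator covers the empty word as well. The frame clause
  protects what was stored before.\<close>

lemma wp_read_loop:
  assumes "up \<in> {up1, up2}" "down \<in> {down1, down2}"
    and "R cur = hd (map letter_code w @ [0])" "xs = tl (map letter_code w @ [0]) @ rest"
    and "heap \<le> R ptr" "R ptr + length w < M"
    and "R up + length w < M" "R down + length w < M" "5 < M"
  shows "wp M (While cur (read_body up down)) (\<lambda>R' xs' n'.
      R' cur = 0 \<and> R' ptr = R ptr + length w \<and> R' up = R up + ups w \<and> R' down = R down + downs w
      \<and> xs' = rest \<and> holds R' (R ptr) w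
      \<and> (\<forall>r. r \<notin> {cur, ptr, tmp, up, down} \<longrightarrow> r < R ptr \<or> R ptr + length w \<le> r \<longrightarrow> R' r = R r)
      \<and> n' \<le> n + 14 * length w + 1) R xs n"
  using assms
proof (induction w arbitrary: R xs n)
  case Nil
  then show ?case by (intro wp_While_unfold) auto
next
  case (Cons l w)
  have code: "letter_code a < M" for a
    using \<open>5 < M\<close> by (cases a) auto
  \<comment> \<open>Truncated subtraction of 2 sends the codes of both \<open>a\<close> letters to
    0, that of \<open>t\<close> to 1 and that of its inverse to 2, which steers the
    branches.\<close>
  have body: "wp M (read_body up down) (\<lambda>R' xs' n'.
      R' cur = hd (map letter_code w @ [0]) \<and> xs' = tl (map letter_code w @ [0]) @ rest
      \<and> R' ptr = Suc (R ptr) \<and> R' up = R up + count_list [l] T_pos \<and> R' down = R down + count_list [l] T_neg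
      \<and> R' (R ptr) = letter_code l
      \<and> (\<forall>r. r \<notin> {cur, ptr, tmp, up, down} \<longrightarrow> r \<noteq> R ptr \<longrightarrow> R' r = R r)
      \<and> n' \<le> n + 13) R xs (Suc n)"
    using Cons.prems
    by (intro vc_sound, elim insertE emptyE; cases l; cases w)
      (simp_all add: read_body_def code)
  show ?case
  proof (rule wp_While_unfold)
    assume "R cur = 0"
    with Cons.prems show "R cur = 0 \<and> R ptr = R ptr + length (l # w) \<and> R up = R up + ups (l # w)
      \<and> R down = R down + downs (l # w)
      \<and> xs = rest \<and> holds R (R ptr) (l # w)
      \<and> (\<forall>r. r \<notin> {cur, ptr, tmp, up, down} \<longrightarrow> r < R ptr \<or> R ptr + length (l # w) \<le> r \<longrightarrow> R r = R r)
      \<and> Suc n \<le> n + 14 * length (l # w) + 1" by (cases l) auto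
  next
    show "wp M (read_body up down) (\<lambda>R1 xs1 n1. wp M (While cur (read_body up down)) (\<lambda>R' xs' n'.
      R' cur = 0 \<and> R' ptr = R ptr + length (l # w) \<and> R' up = R up + ups (l # w)
      \<and> R' down = R down + downs (l # w)
      \<and> xs' = rest \<and> holds R' (R ptr) (l # w)
      \<and> (\<forall>r. r \<notin> {cur, ptr, tmp, up, down} \<longrightarrow> r < R ptr \<or> R ptr + length (l # w) \<le> r \<longrightarrow> R' r = R r)
      \<and> n' \<le> n + 14 * length (l # w) + 1) R1 xs1 (Suc n1)) R xs (Suc n)"
    proof (rule wp_mono[OF body], elim conjE)
      fix R1 xs1 n1
      assume 1: "R1 cur = hd (map letter_code w @ [0])" "xs1 = tl (map letter_code w @ [0]) @ rest"
        "R1 ptr = Suc (R ptr)" "R1 up = R up + count_list [l] T_pos" "R1 down = R down + count_list [l] T_neg"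
        "R1 (R ptr) = letter_code l"
        "\<forall>r. r \<notin> {cur, ptr, tmp, up, down} \<longrightarrow> r \<noteq> R ptr \<longrightarrow> R1 r = R r" "n1 \<le> n + 13"
      show "wp M (While cur (read_body up down)) (\<lambda>R' xs' n'.
        R' cur = 0 \<and> R' ptr = R ptr + length (l # w) \<and> R' up = R up + ups (l # w)
        \<and> R' down = R down + downs (l # w)
        \<and> xs' = rest \<and> holds R' (R ptr) (l # w)
        \<and> (\<forall>r. r \<notin> {cur, ptr, tmp, up, down} \<longrightarrow> r < R ptr \<or> R ptr + length (l # w) \<le> r \<longrightarrow> R' r = R r)
        \<and> n' \<le> n + 14 * length (l # w) + 1) R1 xs1 (Suc n1)"
      proof (rule wp_mono[OF Cons.IH[of R1 xs1 "Suc n1"]], goal_cases)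
        case (10 R' xs' n')
        then show ?case using 1 Cons.prems by auto
      qed (use 1 Cons.prems in \<open>auto split: if_splits\<close>)
    qed
  qed
qed

lemma wp_read_word:
  assumes "up \<in> {up1, up2}" "down \<in> {down1, down2}"
    and "xs = map letter_code w @ 0 # rest"
    and "heap \<le> R ptr" "R ptr + length w + 1 < M"
    and "R up + length w < M" "R down + length w < M" "5 < M"
  shows "wp M (read_word up down) (\<lambda>R' xs' n'.
      R' ptr = R ptr + length w + 1 \<and> R' up = R up + ups w \<and> R' down = R down + downs w
      \<and> xs' = rest \<and> stored R' (R ptr) w
      \<and> (\<forall>r. r \<notin> {cur, ptr, tmp, up, down} \<longrightarrow> r < R ptr \<or> R ptr + length w < r \<longrightarrow> R' r = R r)
      \<and> n' \<le> n + 14 * length w + 4) R xs n"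
proof -
  let ?s = "hd (map letter_code w @ [0])"
  let ?R = "R(cur := ?s)"
  have "wp M (While cur (read_body up down) ;; Basic (Store ptr (Reg cur)) ;; Basic (Add ptr (Imm 1)))
     (\<lambda>R' xs' n'.
      R' ptr = R ptr + length w + 1 \<and> R' up = R up + ups w \<and> R' down = R down + downs w
      \<and> xs' = rest \<and> stored R' (R ptr) w
      \<and> (\<forall>r. r \<notin> {cur, ptr, tmp, up, down} \<longrightarrow> r < R ptr \<or> R ptr + length w < r \<longrightarrow> R' r = R r)
      \<and> n' \<le> n + 14 * length w + 4) ?R (tl xs) (Suc n)"
  proof (rule wp_Seq, rule wp_mono[OF wp_read_loop[where rest = rest and w = w]], goal_cases)
    case (10 R' xs' n')
    have "holds (R'(R ptr + length w := 0, ptr := Suc (R ptr + length w))) (R ptr) w"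
      using 10 assms by (subst holds_cong[of _ _ _ R']) auto
    with 10 assms show ?case
      by (intro vc_sound) (auto simp: stored_def)
  qed (use assms in \<open>cases w; auto\<close>)+
  moreover have "?s < M"
    using assms by (cases w; cases "hd w") auto
  moreover have "(case xs of [] \<Rightarrow> 0 | s # _ \<Rightarrow> s) = ?s"
    using assms by (cases w) auto
  ultimately show ?thesis
    unfolding read_word_def by (intro wp_Seq[of _ "Basic (Read cur)"] vc_sound[of _ "Basic (Read cur)"]) simp
qed

section \<open>Folding the words into tracks\<close>

lemma nat_mod_succ:
  assumes "0 < N"
  shows "nat ((h + 1) mod int N) =
    (if Suc (nat (h mod int N)) = N then 0 else Suc (nat (h mod int N)))"
proof -
  let ?p = "nat (h mod int N)"
  have p: "int ?p = h mod int N" "?p < N" using assms by (simp_all add: nat_less_iff)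
  have "(h + 1) mod int N = int (Suc ?p) mod int N"
    using p(1) by (simp add: mod_add_left_eq add.commute mod_add_right_eq)
  then have "nat ((h + 1) mod int N) = Suc ?p mod N" by (simp only: nat_int flip: of_nat_mod)
  then show ?thesis using p(2) by (simp only: mod_Suc mod_less)
qed

text \<open>The form mirrors \<open>fold_body\<close>, which replaces the lowest position by
  \<open>hi\<close> before decrementing, so that heights are reduced modulo \<open>N\<close> without
  division.\<close>

lemma nat_mod_pred:
  assumes "0 < N"
  shows "nat ((h - 1) mod int N) =
    (if nat (h mod int N) = 0 then N else nat (h mod int N)) - 1"
  using nat_mod_succ[OF assms, of "h - 1"] assms by (auto split: if_splits)

text \<open>The induction needs an arbitrary starting height \<open>h\<close> and arbitrary track
  contents \<beta>. The letter in \<open>cur\<close> comes from address \<open>a\<close>, so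
  \<open>ip\<close> is one ahead. The word lies below \<open>L\<close>, hence toggling lamps cannot
  damage it.\<close>

lemma wp_fold_loop:
  assumes "R cur = R a" "R ip = Suc a" "stored R a w" "heap \<le> a" "a + length w < L"
    and "R lo = L" "R hi = L + N" "0 < N" "R pos = L + nat (h mod int N)"
    and "\<And>r. r < N \<Longrightarrow> R (L + r) = of_bool (\<beta> r = 1)" "L + N < M"
  shows "wp M (While cur fold_body) (\<lambda>R' xs' n'.
      R' ip = Suc (a + length w)
      \<and> (\<forall>r<N. R' (L + r) = of_bool (\<beta> r + lamp (int N) w h (int r) = 1))
      \<and> (\<forall>r. r \<notin> {cur, ip, pos, tmp, val1} \<longrightarrow> r < L \<or> L + N \<le> r \<longrightarrow> R' r = R r)
      \<and> n' \<le> n + 16 * length w + 1) R xs n"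
  using assms
proof (induction w arbitrary: R a h \<beta> xs n)
  case Nil
  then show ?case by (intro wp_While_unfold) (auto simp: stored_def)
next
  case (Cons l w)
  define h' where "h' = h + (case l of T_pos \<Rightarrow> 1 | T_neg \<Rightarrow> - 1 | _ \<Rightarrow> 0)"
  define p where "p = nat (h mod int N)"
  have p: "p < N" "R pos = L + p" using Cons.prems by (simp_all add: p_def nat_less_iff)
  \<comment> \<open>Track contents after the letter \<open>l\<close>: cell \<open>p\<close> is
    toggled by an \<open>a\<close> letter, and nothing changes otherwise.\<close>
  define \<beta>' where "\<beta>' r = \<beta> r + (case l of T_pos \<Rightarrow> 0 | T_neg \<Rightarrow> 0 | _ \<Rightarrow> of_bool (r = p))" for r
  have lamp: "\<beta> r + lamp (int N) (l # w) h (int r) = \<beta>' r + lamp (int N) w h' (int r)" if "r < N" for r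
  proof -
    have "int r mod int N = h mod int N \<longleftrightarrow> r = p"
      using that \<open>0 < N\<close> by (auto simp: p_def nat_eq_iff)
    then show ?thesis by (cases l) (simp_all add: h'_def \<beta>'_def add.assoc)
  qed
  have Rl: "R a = letter_code l" and Rw: "stored R (Suc a) w"
    using Cons.prems(3) by (simp_all add: stored_Cons)
  have up: "nat ((h + 1) mod int N) = (if Suc p = N then 0 else Suc p)"
    and down: "nat ((h - 1) mod int N) = (if p = 0 then N else p) - 1"
    using nat_mod_succ nat_mod_pred \<open>0 < N\<close> by (simp_all add: p_def)
  have body: "wp M fold_body (\<lambda>R' xs' n'.
      R' cur = R (Suc a) \<and> R' ip = Suc (Suc a) \<and> R' pos = L + nat (h' mod int N)
      \<and> (\<forall>r<N. R' (L + r) = of_bool (\<beta>' r = 1))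
      \<and> (\<forall>r. r \<notin> {cur, ip, pos, tmp, val1} \<longrightarrow> r < L \<or> L + N \<le> r \<longrightarrow> R' r = R r)
      \<and> n' \<le> n + 15) R xs (Suc n)"
    using Cons.prems p Rl up down
    by (intro vc_sound, cases l)
      (auto simp: fold_body_def h'_def \<beta>'_def p_def[symmetric] bit_not_one_iff)
  show ?case
  proof (rule wp_While_unfold)
    assume "R cur = 0"
    with Cons.prems(1) Rl show "R ip = Suc (a + length (l # w))
      \<and> (\<forall>r<N. R (L + r) = of_bool (\<beta> r + lamp (int N) (l # w) h (int r) = 1))
      \<and> (\<forall>r. r \<notin> {cur, ip, pos, tmp, val1} \<longrightarrow> r < L \<or> L + N \<le> r \<longrightarrow> R r = R r)
      \<and> Suc n \<le> n + 16 * length (l # w) + 1" by (cases l) auto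
  next
    show "wp M fold_body (\<lambda>R1 xs1 n1. wp M (While cur fold_body) (\<lambda>R' xs' n'.
        R' ip = Suc (a + length (l # w))
        \<and> (\<forall>r<N. R' (L + r) = of_bool (\<beta> r + lamp (int N) (l # w) h (int r) = 1))
        \<and> (\<forall>r. r \<notin> {cur, ip, pos, tmp, val1} \<longrightarrow> r < L \<or> L + N \<le> r \<longrightarrow> R' r = R r)
        \<and> n' \<le> n + 16 * length (l # w) + 1) R1 xs1 (Suc n1)) R xs (Suc n)"
    proof (rule wp_mono[OF body], elim conjE)
      fix R1 xs1 n1
      assume 1: "R1 cur = R (Suc a)" "R1 ip = Suc (Suc a)" "R1 pos = L + nat (h' mod int N)"
        "\<forall>r<N. R1 (L + r) = of_bool (\<beta>' r = 1)"
        "\<forall>r. r \<notin> {cur, ip, pos, tmp, val1} \<longrightarrow> r < L \<or> L + N \<le> r \<longrightarrow> R1 r = R r"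
        "n1 \<le> n + 15"
      have "stored R1 (Suc a) w"
        using Rw 1(5) Cons.prems(4,5) by (subst stored_cong[of _ _ _ R]) auto
      with 1 Cons.prems show "wp M (While cur fold_body) (\<lambda>R' xs' n'.
          R' ip = Suc (a + length (l # w))
          \<and> (\<forall>r<N. R' (L + r) = of_bool (\<beta> r + lamp (int N) (l # w) h (int r) = 1))
          \<and> (\<forall>r. r \<notin> {cur, ip, pos, tmp, val1} \<longrightarrow> r < L \<or> L + N \<le> r \<longrightarrow> R' r = R r)
          \<and> n' \<le> n + 16 * length (l # w) + 1) R1 xs1 (Suc n1)"
        by (intro wp_mono[OF Cons.IH[of R1 "Suc a" h' \<beta>' "Suc n1" xs1]])
          (auto simp: lamp simp del: lamp.simps)
    qed
  qed
qed

lemma wp_fold_word: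
  assumes "R ip = a" "stored R a w" "heap \<le> a" "a + length w < R lo"
    and "R modulus = N" "0 < N" "\<And>r. r < N \<Longrightarrow> R (R lo + r) = 0" "R lo + N < M"
  shows "wp M fold_word (\<lambda>R' xs' n'.
      R' ip = Suc (a + length w) \<and> R' hi = R lo + N
      \<and> (\<forall>r<N. R' (R lo + r) = track N w r)
      \<and> (\<forall>r. r \<notin> {cur, ip, pos, hi, tmp, val1} \<longrightarrow> r < R lo \<or> R lo + N \<le> r \<longrightarrow> R' r = R r)
      \<and> n' \<le> n + 16 * length w + 6) R xs n"
proof -
  let ?R = "R(hi := R lo + N, pos := R lo, cur := R a, ip := Suc a)"
  have "stored ?R a w"
    using assms by (subst stored_cong[of _ _ _ R]) auto
  then have "wp M (While cur fold_body) (\<lambda>R' xs' n'.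
      R' ip = Suc (a + length w) \<and> R' hi = R lo + N
      \<and> (\<forall>r<N. R' (R lo + r) = track N w r)
      \<and> (\<forall>r. r \<notin> {cur, ip, pos, hi, tmp, val1} \<longrightarrow> r < R lo \<or> R lo + N \<le> r \<longrightarrow> R' r = R r)
      \<and> n' \<le> n + 16 * length w + 6) ?R xs (n + 5)"
    using assms
    by (intro wp_mono[OF wp_fold_loop[where a = a and L = "R lo" and N = N and h = 0 and \<beta> = "\<lambda>_. 0"]])
      (auto simp: track_def)
  with assms show ?thesis
    unfolding fold_word_def by (intro vc_sound) (simp add: numeral_eq_Suc)
qed

section \<open>Comparing the two tracks\<close>

lemma wp_fetch:
  assumes "dst \<in> {val1, val2}" "base \<in> {ptr, lo}" "idx \<in> {idx1, idx2}"
    and "R modulus = N" "R idx < N" "R matched < N" "heap \<le> R base" "R base + 2 * N < M"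
    and "\<And>r. r < N \<Longrightarrow> R (R base + r) = \<gamma> r" "periodic N \<gamma>"
  shows "wp M (fetch dst base idx) (\<lambda>R' xs' n'.
      R' dst = \<gamma> (R idx + R matched) \<and> (\<forall>r. r \<notin> {tmp, dst} \<longrightarrow> R' r = R r) \<and> xs' = xs \<and> n' \<le> n + 10) R xs n"
proof (cases "R idx + R matched < N")
  case True
  then have "R (R idx + R matched + R base) = \<gamma> (R idx + R matched)"
    using assms(9)[of "R idx + R matched"] by (simp add: add.commute)
  with True show ?thesis using assms(1-8)
    by (intro vc_sound) (elim insertE emptyE; simp add: fetch_def)
next
  case False
  \<comment> \<open>The index wraps around once: cell \<open>m\<close> is read in place of
    \<open>m + N\<close>, and periodicity of \<gamma> makes the two agree.\<close>
  then obtain m where m: "R idx + R matched = m + N"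
    by (metis le_add_diff_inverse2 not_less)
  have "m < N" using assms(5,6) m by linarith
  moreover have "\<gamma> (m + N) = \<gamma> m"
    using assms(10) by (simp add: periodic_def)
  ultimately have "R (m + R base) = \<gamma> (m + N)"
    using assms(9)[of m] by (simp only: add.commute)
  with m show ?thesis using assms(1-4,7,8) \<open>m < N\<close>
    by (intro vc_sound) (elim insertE emptyE; simp add: fetch_def)
qed

lemma wp_test_indices:
  assumes "R modulus = N"
  shows "wp M test_indices (\<lambda>R' xs' n'.
      (R' cur = 0 \<longleftrightarrow> N \<le> R idx1 \<or> N \<le> R idx2 \<or> N \<le> R matched)
      \<and> (\<forall>r. r \<noteq> cur \<longrightarrow> R' r = R r)
      \<and> xs' = xs \<and> n' \<le> n + 11) R xs n"
  using assms by (intro vc_sound) (auto simp: test_indices_def)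

text \<open>An index can overshoot \<open>N\<close> in the last round, but from values below
  \<open>N\<close> it becomes at most \<open>(N - 1) + (N - 1) + 1\<close>, whence the bound
  \<open>2 * N\<close>.\<close>

definition compare_inv :: "(nat \<Rightarrow> nat) \<Rightarrow> (nat \<Rightarrow> nat) \<Rightarrow> nat \<Rightarrow> (nat \<Rightarrow> nat) \<Rightarrow> bool" where
  "compare_inv \<alpha> \<beta> N R \<longleftrightarrow> R modulus = N
     \<and> (\<forall>r<N. R (R ptr + r) = \<alpha> r) \<and> (\<forall>r<N. R (R lo + r) = \<beta> r)
     \<and> heap \<le> R ptr \<and> heap \<le> R lo
     \<and> cyc_inv \<alpha> \<beta> (R idx1) (R idx2) (R matched)
     \<and> R idx1 < 2 * N \<and> R idx2 < 2 * N \<and> R matched \<le> N"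

lemma compare_inv_cong:
  assumes "compare_inv \<alpha> \<beta> N R" "\<And>r. r \<notin> {cur, tmp, val1, val2} \<Longrightarrow> R' r = R r"
  shows "compare_inv \<alpha> \<beta> N R'"
  using assms by (auto simp: compare_inv_def)

text \<open>Each round raises this sum by exactly one, and \<open>compare_inv\<close> keeps it at
  most \<open>5 * N\<close>; this makes the comparison linear.\<close>

definition progress :: "(nat \<Rightarrow> nat) \<Rightarrow> nat" where
  "progress R = R idx1 + R idx2 + R matched"

lemma wp_advance:
  assumes inv: "compare_inv \<alpha> \<beta> N R" and less: "R idx1 < N" "R idx2 < N" "R matched < N"
    and "R val1 = \<alpha> (R idx1 + R matched)" "R val2 = \<beta> (R idx2 + R matched)" "2 * N < M"
  shows "wp M advance (\<lambda>R' xs' n'.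
      compare_inv \<alpha> \<beta> N R' \<and> R' ptr = R ptr \<and> R' lo = R lo
      \<and> progress R' = Suc (progress R) \<and> n' \<le> n + 10) R xs n"
proof -
  consider "R val1 < R val2" | "R val1 = R val2" | "R val1 > R val2" by linarith
  then show ?thesis
  proof cases
    case 1
    with assms cyc_inv_lt[of \<alpha> \<beta> "R idx1" "R idx2" "R matched"] show ?thesis
      by (intro vc_sound) (auto simp: advance_def skip_rotations_def compare_inv_def progress_def)
  next
    case 2
    with assms cyc_inv_match[of \<alpha> \<beta> "R idx1" "R idx2" "R matched"] show ?thesis
      by (intro vc_sound) (auto simp: advance_def skip_rotations_def compare_inv_def progress_def)
  next
    case 3
    with assms cyc_inv_gt[of \<alpha> \<beta> "R idx1" "R idx2" "R matched"] show ?thesis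
      by (intro vc_sound) (auto simp: advance_def skip_rotations_def compare_inv_def progress_def)
  qed
qed

lemma wp_compare_body:
  assumes inv: "compare_inv \<alpha> \<beta> N R" and less: "R idx1 < N" "R idx2 < N" "R matched < N"
    and per: "periodic N \<alpha>" "periodic N \<beta>"
    and M: "R ptr + 2 * N < M" "R lo + 2 * N < M"
  shows "wp M compare_body (\<lambda>R' xs' n'.
      compare_inv \<alpha> \<beta> N R' \<and> R' ptr = R ptr \<and> R' lo = R lo
      \<and> (R' cur = 0 \<longleftrightarrow> N \<le> R' idx1 \<or> N \<le> R' idx2 \<or> N \<le> R' matched)
      \<and> progress R' = Suc (progress R) \<and> n' \<le> n + 41) R xs n"
  unfolding compare_body_def
proof (rule wp_Seq, rule wp_mono[OF wp_fetch[where \<gamma> = \<alpha> and N = N]], goal_cases)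
  case (11 R1 xs1 n1)
  then have 1: "R1 val1 = \<alpha> (R idx1 + R matched)" "\<And>r. r \<notin> {tmp, val1} \<Longrightarrow> R1 r = R r" "n1 \<le> n + 10"
    by blast+
  have inv1: "compare_inv \<alpha> \<beta> N R1" using compare_inv_cong[OF inv] 1(2) by simp
  have less1: "R1 idx2 < N" "R1 matched < N" "R1 lo + 2 * N < M" using 1(2) less M by simp_all
  show ?case
  proof (rule wp_Seq, rule wp_mono[OF wp_fetch[where \<gamma> = \<beta> and N = N]], goal_cases)
    case (11 R2 xs2 n2)
    then have fetched: "R2 val2 = \<beta> (R1 idx2 + R1 matched)" "\<And>r. r \<notin> {tmp, val2} \<Longrightarrow> R2 r = R1 r" "n2 \<le> n1 + 10"
      by blast+
    have inv2: "compare_inv \<alpha> \<beta> N R2" using compare_inv_cong[OF inv1] fetched(2) by simp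
    show ?case
    proof (rule wp_Seq, rule wp_mono[OF wp_advance[OF inv2]], goal_cases)
      case (7 R3 xs3 n3)
      show ?case
      proof (rule wp_mono[OF wp_test_indices[of R3 N]], goal_cases)
        case (2 R4 xs4 n4)
        then have 4: "\<And>r. r \<noteq> cur \<Longrightarrow> R4 r = R3 r" by blast
        have "compare_inv \<alpha> \<beta> N R4"
          using compare_inv_cong[of \<alpha> \<beta> N R3 R4] 7 4 by simp
        moreover have "progress R4 = progress R3" "progress R2 = progress R"
          by (simp_all add: progress_def 4 fetched(2) 1(2))
        ultimately show ?case using 2 7 1 fetched 4 by simp
      qed (use 7 in \<open>simp add: compare_inv_def\<close>)
    qed (use 1 fetched less M in simp_all)
  qed (use inv1 less1 per in \<open>simp_all add: compare_inv_def\<close>)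
qed (use inv less M per in \<open>simp_all add: compare_inv_def\<close>)

lemma wp_compare_tracks:
  assumes N: "0 < N" "R modulus = N"
    and tracks: "\<And>r. r < N \<Longrightarrow> R (R ptr + r) = \<alpha> r" "\<And>r. r < N \<Longrightarrow> R (R lo + r) = \<beta> r"
    and per: "periodic N \<alpha>" "periodic N \<beta>"
    and heap: "heap \<le> R ptr" "heap \<le> R lo"
    and M: "R ptr + 2 * N < M" "R lo + 2 * N < M"
  shows "wp M compare_tracks (\<lambda>R' xs' n'.
      (R' ans \<noteq> 0 \<longleftrightarrow> is_rotation \<alpha> \<beta>) \<and> n' \<le> n + 250 * N + 20) R xs n"
proof -
  \<comment> \<open>The constant \<open>14\<close> covers three assignments and the first
    \<open>test_indices\<close>. Each unit of \<open>progress\<close> pays \<open>50\<close> for one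
    round, which takes at most 41 steps besides the loop test and the jump back.\<close>
  define I where "I R' xs' n' \<longleftrightarrow> compare_inv \<alpha> \<beta> N R' \<and> R' ptr = R ptr \<and> R' lo = R lo
      \<and> (R' cur = 0 \<longleftrightarrow> N \<le> R' idx1 \<or> N \<le> R' idx2 \<or> N \<le> R' matched)
      \<and> n' \<le> n + 14 + 50 * progress R'" for R' and xs' :: "nat list" and n'
  let ?R = "R(idx1 := 0, idx2 := 0, matched := 0)"
  have loop: "wp M (While cur compare_body) (\<lambda>R' xs' n'.
      compare_inv \<alpha> \<beta> N R' \<and> (N \<le> R' idx1 \<or> N \<le> R' idx2 \<or> N \<le> R' matched)
      \<and> n' \<le> n + 250 * N + 15) R1 xs1 n1" if "I R1 xs1 n1" for R1 xs1 n1
  proof (rule wp_While[where I = I and B = "n + 14 + 50 * (5 * N)"])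
    show "wp M compare_body (\<lambda>R' xs' n'. I R' xs' (Suc n')) R2 xs2 (Suc n2)"
      if I: "I R2 xs2 n2" and cur: "R2 cur \<noteq> 0" for R2 xs2 n2
      using I cur M
      by (intro wp_mono[OF wp_compare_body[where \<alpha> = \<alpha> and \<beta> = \<beta> and N = N and R = R2]])
        (simp_all add: I_def per)
    show "n2 \<le> n + 14 + 50 * (5 * N)" if "I R2 xs2 n2" for R2 xs2 n2
      using that by (auto simp: I_def compare_inv_def progress_def)
    show "compare_inv \<alpha> \<beta> N R2 \<and> (N \<le> R2 idx1 \<or> N \<le> R2 idx2 \<or> N \<le> R2 matched)
      \<and> Suc n2 \<le> n + 250 * N + 15" if "I R2 xs2 n2" "R2 cur = 0" for R2 xs2 n2
      using that by (auto simp: I_def compare_inv_def progress_def)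
  qed (rule that)
  have finish: "wp M (Basic (Assign ans (Reg matched)) ;; Basic (Add ans (Imm 1)) ;; Basic (Sub ans (Reg modulus)))
      (\<lambda>R' xs' n'. (R' ans \<noteq> 0 \<longleftrightarrow> is_rotation \<alpha> \<beta>) \<and> n' \<le> n + 250 * N + 20) R1 xs1 n1"
    if "compare_inv \<alpha> \<beta> N R1" "N \<le> R1 idx1 \<or> N \<le> R1 idx2 \<or> N \<le> R1 matched"
      "n1 \<le> n + 250 * N + 15" for R1 xs1 n1
  proof -
    have "is_rotation \<alpha> \<beta> \<longleftrightarrow> N \<le> R1 matched"
      using that by (intro cyc_inv_final[OF N(1) per]) (auto simp: compare_inv_def)
    moreover have "R1 modulus = N" "Suc (R1 matched) < M"
      using that(1) M N(1) heap(1) by (auto simp: compare_inv_def)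
    ultimately show ?thesis using that(3) by (intro vc_sound) auto
  qed
  have "wp M (test_indices ;; While cur compare_body ;;
      Basic (Assign ans (Reg matched)) ;; Basic (Add ans (Imm 1)) ;; Basic (Sub ans (Reg modulus)))
      (\<lambda>R' xs' n'. (R' ans \<noteq> 0 \<longleftrightarrow> is_rotation \<alpha> \<beta>) \<and> n' \<le> n + 250 * N + 20) ?R xs (Suc (Suc (Suc n)))"
  proof (rule wp_Seq, rule wp_mono[OF wp_test_indices[where N = N]], goal_cases)
    case (2 R1 xs1 n1)
    then have 1: "R1 cur = 0 \<longleftrightarrow> N \<le> R1 idx1 \<or> N \<le> R1 idx2 \<or> N \<le> R1 matched"
      "\<And>r. r \<noteq> cur \<Longrightarrow> R1 r = ?R r" "n1 \<le> n + 14"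
      by auto
    have "compare_inv \<alpha> \<beta> N ?R"
      using N tracks heap by (simp add: compare_inv_def cyc_inv_def)
    then have "compare_inv \<alpha> \<beta> N R1" by (rule compare_inv_cong) (use 1(2) in simp)
    then have "I R1 xs1 n1" using 1 by (simp add: I_def)
    then show ?case
      by (intro wp_Seq[of _ "While cur compare_body"] wp_mono[OF loop]) (use finish in blast)+
  qed (use N in simp)
  with N M show ?thesis
    unfolding compare_tracks_def by (simp add: wp_Basic_Seq)
qed

section \<open>Composing the phases\<close>

definition height_pair :: "(nat \<Rightarrow> nat) \<Rightarrow> letter list \<Rightarrow> letter list \<Rightarrow> bool" where
  "height_pair R u v \<longleftrightarrow>
     R up1 = ups u \<and> R down1 = downs u \<and> R up2 = ups v \<and> R down2 = downs v"

text \<open>With one zero after each word, \<open>u\<close> starts at \<open>heap = 20\<close>,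
  \<open>v\<close> at \<open>21 + length u\<close>, and the first free cell is
  \<open>22 + length u + length v\<close>.\<close>

lemma wp_read_words:
  assumes M: "20 * (22 + length u + length v) \<le> M"
  shows "wp M (Basic (Assign ptr (Imm heap)) ;; read_word up1 down1 ;; read_word up2 down2)
    (\<lambda>R xs n. R ptr = 22 + length u + length v \<and> height_pair R u v
      \<and> stored R heap u \<and> stored R (21 + length u) v
      \<and> (\<forall>r. tmp < r \<longrightarrow> r < heap \<or> 22 + length u + length v \<le> r \<longrightarrow> R r = 0)
      \<and> n \<le> 14 * (length u + length v) + 9) (\<lambda>_. 0) (encode_pair (u, v)) 0"
proof -
  let ?e = "22 + length u + length v"
  let ?R = "(\<lambda>_. 0)(ptr := heap)"
  have "wp M (read_word up1 down1 ;; read_word up2 down2)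
    (\<lambda>R xs n. R ptr = ?e \<and> height_pair R u v \<and> stored R heap u \<and> stored R (21 + length u) v
      \<and> (\<forall>r. tmp < r \<longrightarrow> r < heap \<or> ?e \<le> r \<longrightarrow> R r = 0)
      \<and> n \<le> 14 * (length u + length v) + 9) ?R (encode_pair (u, v)) (Suc 0)"
  proof (rule wp_Seq, rule wp_mono[OF wp_read_word[where w = u and rest = "map letter_code v @ [0]"]], goal_cases)
    case (9 R1 xs1 n1)
    then have read1: "R1 ptr = 21 + length u" "R1 up1 = ups u" "R1 down1 = downs u"
      "xs1 = map letter_code v @ [0]" "stored R1 heap u" "n1 \<le> 14 * length u + 5"
      "\<And>r. r \<notin> {cur, ptr, tmp, up1, down1} \<Longrightarrow> r < heap \<or> heap + length u < r \<Longrightarrow> R1 r = 0"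
      by auto
    show ?case
    proof (rule wp_mono[OF wp_read_word[where w = v and rest = "[]"]], goal_cases)
      case (9 R2 xs2 n2)
      then have read2: "R2 ptr = ?e" "R2 up2 = ups v" "R2 down2 = downs v"
        "stored R2 (21 + length u) v" "n2 \<le> n1 + 14 * length v + 4"
        "\<And>r. r \<notin> {cur, ptr, tmp, up2, down2} \<Longrightarrow> r < 21 + length u \<or> 21 + length u + length v < r
           \<Longrightarrow> R2 r = R1 r"
        using read1 by (auto simp: read1(7))
      have "stored R2 heap u"
        using read1(5) by (subst stored_cong[of _ _ _ R1]) (simp_all add: read2(6))
      moreover have "R2 r = 0" if "tmp < r" "r < heap \<or> ?e \<le> r" for r
        using that read2(6)[of r] read1(7)[of r] by fastforce
      moreover have "height_pair R2 u v"
        using read1 read2 by (simp add: height_pair_def)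
      ultimately show ?case using read1(6) read2 by simp
    qed (use M read1 in simp_all)
  qed (use M in \<open>simp_all add: encode_pair_def\<close>)
  with M show ?thesis by (simp add: wp_Basic_Seq)
qed

lemma wp_height_difference:
  assumes "height_pair R u v" "length u + length v < M"
  shows "wp M height_difference (\<lambda>R' xs' n'.
    (R' val2 = 0 \<longleftrightarrow> height u = height v)
    \<and> (\<forall>r. r \<notin> {tmp, val1, val2} \<longrightarrow> R' r = R r) \<and> n' \<le> n + 8) R xs n"
  using assms ups_plus_downs_le[of u] ups_plus_downs_le[of v]
  by (intro vc_sound) (auto simp: height_difference_def height_def height_pair_def)

lemma wp_set_modulus:
  assumes "height_pair R u v" "R ptr = e" "4 * e < M" "length u < e"
  shows "wp M set_modulus (\<lambda>R' xs' n'.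
    R' modulus = (if height u = 0 then 4 * e else nat \<bar>height u\<bar>)
    \<and> (\<forall>r. r \<notin> {tmp, modulus} \<longrightarrow> R' r = R r) \<and> n' \<le> n + 10) R xs n"
  using assms ups_plus_downs_le[of u]
  by (intro vc_sound) (auto simp: set_modulus_def height_def height_pair_def)

text \<open>The tracks occupy two consecutive blocks of \<open>N\<close> cells from \<open>e\<close>
  on. These cells must be zero beforehand, as folding starts with all lamps off.\<close>

lemma wp_fold_words:
  assumes "R ptr = e" "e = 22 + length u + length v" "stored R heap u" "stored R (21 + length u) v"
    and "\<And>r. e \<le> r \<Longrightarrow> R r = 0" "R modulus = N" "0 < N" "e + 2 * N < M"
  shows "wp M fold_words (\<lambda>R' xs' n'.
    R' ptr = e \<and> R' lo = e + N \<and> R' modulus = N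
    \<and> (\<forall>r<N. R' (e + r) = track N u r) \<and> (\<forall>r<N. R' (e + N + r) = track N v r)
    \<and> n' \<le> n + 16 * e) R xs n"
proof -
  let ?R = "R(ip := heap, lo := e)"
  have "wp M (fold_word ;; Basic (Assign lo (Reg hi)) ;; fold_word)
   (\<lambda>R' xs' n'.
    R' ptr = e \<and> R' lo = e + N \<and> R' modulus = N
    \<and> (\<forall>r<N. R' (e + r) = track N u r) \<and> (\<forall>r<N. R' (e + N + r) = track N v r)
    \<and> n' \<le> n + 16 * e) ?R xs (Suc (Suc n))"
  proof (rule wp_Seq, rule wp_mono[OF wp_fold_word[where w = u and N = N and a = heap]], goal_cases)
    case (9 R1 xs1 n1)
    then have fold1: "R1 ip = 21 + length u" "R1 hi = e + N" "\<And>r. r < N \<Longrightarrow> R1 (e + r) = track N u r"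
      "\<And>r. r \<notin> {cur, ip, pos, hi, tmp, val1, lo} \<Longrightarrow> r < e \<or> e + N \<le> r \<Longrightarrow> R1 r = R r"
      "n1 \<le> n + 16 * length u + 8"
      by auto
    let ?R1 = "R1(lo := e + N)"
    have "stored ?R1 (21 + length u) v"
      using assms(2,4) by (subst stored_cong[of _ _ _ R]) (auto simp: fold1(4))
    then have "wp M fold_word (\<lambda>R' xs' n'.
      R' ptr = e \<and> R' lo = e + N \<and> R' modulus = N
      \<and> (\<forall>r<N. R' (e + r) = track N u r) \<and> (\<forall>r<N. R' (e + N + r) = track N v r)
      \<and> n' \<le> n + 16 * e) ?R1 xs1 (Suc n1)"
      using assms fold1
      by (intro wp_mono[OF wp_fold_word[where w = v and N = N and a = "21 + length u"]])
        (auto simp: add.assoc)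
    then show ?case using fold1(2) by (simp add: wp_Basic_Seq)
  next
    case 2
    then show ?case using assms by (subst stored_cong[of _ _ _ R]) auto
  qed (use assms in auto)
  with assms show ?thesis
    unfolding fold_words_def by (simp add: wp_Basic_Seq)
qed

text \<open>Since \<open>N \<le> 4 * e\<close>, the comparison needs registers up to
  \<open>e + 3 * N \<le> 13 * e\<close> only, and its \<open>250 * N\<close> steps are at most
  \<open>1000 * e\<close>; the remaining \<open>100 * e\<close> cover all other phases.\<close>

lemma wp_conjugacy_com:
  assumes M: "20 * (22 + length u + length v) \<le> M"
  shows "wp M conjugacy_com (\<lambda>R xs n. n < 1100 * (22 + length u + length v)
      \<and> (R ans \<noteq> 0 \<longleftrightarrow> conjugate_in lamplighter (word_val u) (word_val v)))
    (\<lambda>_. 0) (encode_pair (u, v)) 0"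
proof -
  define e where "e = 22 + length u + length v"
  define N where "N = (if height u = 0 then 4 * e else nat \<bar>height u\<bar>)"
  define conj where "conj \<longleftrightarrow> conjugate_in lamplighter (word_val u) (word_val v)"
  let ?Q = "\<lambda>R (xs :: nat list) n. n < 1100 * e \<and> (R ans \<noteq> 0 \<longleftrightarrow> conj)"
  have N: "0 < N" "N \<le> 4 * e"
    using ups_plus_downs_le[of u] by (auto simp: N_def e_def height_def)
  have "(height u \<noteq> 0 \<longrightarrow> int N = \<bar>height u\<bar>)
      \<and> (height u = 0 \<longrightarrow> 4 * int (length u + length v) < int N)"
    by (simp add: N_def e_def)
  then have conj: "conj \<longleftrightarrow> height u = height v \<and> is_rotation (track N u) (track N v)"
    unfolding conj_def is_rotation_track_iff[OF N(1)] by (intro conjugate_word_val_iff) blast+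
  have compare: "wp M (IfZero val2 (set_modulus ;; fold_words ;; compare_tracks) Skip) ?Q R xs n"
    if R: "R ptr = e" "height_pair R u v" "stored R heap u" "stored R (21 + length u) v"
      "\<And>r. e \<le> r \<Longrightarrow> R r = 0" "R ans = 0" "R val2 = 0 \<longleftrightarrow> height u = height v"
      and n: "n \<le> 15 * e" for R xs n
  proof (rule wp_IfZero)
    assume "R val2 = 0"
    then have conj': "conj \<longleftrightarrow> is_rotation (track N u) (track N v)" using conj R(7) by simp
    show "wp M (set_modulus ;; fold_words ;; compare_tracks) ?Q R xs (Suc n)"
    proof (rule wp_Seq, rule wp_mono[OF wp_set_modulus[OF R(2,1)]], goal_cases)
      case (3 R1 xs1 n1)
      then have modulus: "R1 modulus = N" "\<And>r. r \<notin> {tmp, modulus} \<Longrightarrow> R1 r = R r" "n1 \<le> Suc n + 10"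
        by (auto simp: N_def)
      have tapes: "stored R1 heap u" "stored R1 (21 + length u) v"
        using R(3,4) by (subst stored_cong[of _ _ _ R]; simp add: modulus(2))+
      show ?case
      proof (rule wp_Seq, rule wp_mono[OF wp_fold_words[where e = e and u = u and v = v and N = N]], goal_cases)
        case (9 R2 xs2 n2)
        then have fold: "R2 ptr = e" "R2 lo = e + N" "R2 modulus = N"
          "\<And>r. r < N \<Longrightarrow> R2 (e + r) = track N u r" "\<And>r. r < N \<Longrightarrow> R2 (e + N + r) = track N v r"
          "n2 \<le> n1 + 16 * e"
          by auto
        have "n2 + 250 * N + 20 < 1100 * e" using fold(6) modulus(3) n N(2) by (simp add: e_def)
        then show ?case
          using fold N M e_def
          by (intro wp_mono[OF wp_compare_tracks[where N = N and \<alpha> = "track N u" and \<beta> = "track N v"]])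
            (auto simp: conj' periodic_track)
      qed (use R modulus tapes N M e_def in auto)
    qed (use M e_def in auto)
  next
    assume "R val2 \<noteq> 0"
    then have "\<not> conj" using conj R(7) by simp
    \<comment> \<open>The register \<open>ans\<close> still holds its initial zero, so words of
      different height are rejected.\<close>
    then show "wp M Skip (\<lambda>R xs n. ?Q R xs (Suc n)) R xs (Suc n)"
      using n R(6) by (intro wp_Skip) (auto simp: e_def)
  qed
  have "wp M (height_difference ;; IfZero val2 (set_modulus ;; fold_words ;; compare_tracks) Skip) ?Q R xs n"
    if R: "R ptr = e" "height_pair R u v" "stored R heap u" "stored R (21 + length u) v"
      "\<And>r. tmp < r \<Longrightarrow> r < heap \<or> e \<le> r \<Longrightarrow> R r = 0" "n \<le> 14 * (length u + length v) + 9" for R xs n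
  proof (rule wp_Seq, rule wp_mono[OF wp_height_difference[OF R(2)]], goal_cases)
    case (2 R1 xs1 n1)
    then have diff: "R1 val2 = 0 \<longleftrightarrow> height u = height v"
      "\<And>r. r \<notin> {tmp, val1, val2} \<Longrightarrow> R1 r = R r" "n1 \<le> n + 8"
      by auto
    have "stored R1 heap u" "stored R1 (21 + length u) v"
      using R(3,4) by (subst stored_cong[of _ _ _ R]; simp add: diff(2))+
    moreover have "height_pair R1 u v" using R(2) by (simp add: height_pair_def diff(2))
    moreover have "R1 r = 0" if "e \<le> r" for r using R(5)[of r] diff(2)[of r] that by (simp add: e_def)
    ultimately show ?case
      using R(1,5,6) diff by (intro compare) (auto simp: e_def)
  qed (use M in simp)
  then have "wp M ((Basic (Assign ptr (Imm heap)) ;; read_word up1 down1 ;; read_word up2 down2) ;;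
      height_difference ;; IfZero val2 (set_modulus ;; fold_words ;; compare_tracks) Skip) ?Q
      (\<lambda>_. 0) (encode_pair (u, v)) 0"
    by (intro wp_Seq[OF wp_mono[OF wp_read_words[OF M]]]) (auto simp: e_def)
  \<comment> \<open>Both bracketings of \<open>;;\<close> compile to the same code.\<close>
  then have "wp M conjugacy_com ?Q (\<lambda>_. 0) (encode_pair (u, v)) 0"
    unfolding conjugacy_com_def by (simp add: wp_def add.assoc)
  then show ?thesis by (simp add: e_def conj_def)
qed

section \<open>Size of the machine words\<close>

lemma word_size_bound:
  fixes n :: nat
  shows "20 * (22 + n) \<le> 2 ^ (5 + nat \<lceil>log 2 (real (22 + n))\<rceil>)"
proof -
  have "22 + real n = 2 powr log 2 (real (22 + n))" by simp
  also have "\<dots> \<le> 2 powr real (nat \<lceil>log 2 (real (22 + n))\<rceil>)"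
    by (intro powr_mono) linarith+
  also have "\<dots> = 2 ^ nat \<lceil>log 2 (real (22 + n))\<rceil>" by (rule powr_realpow) simp
  finally have "real (22 + n) \<le> real (2 ^ nat \<lceil>log 2 (real (22 + n))\<rceil>)" by simp
  then have "22 + n \<le> 2 ^ nat \<lceil>log 2 (real (22 + n))\<rceil>" by (simp only: of_nat_le_iff)
  \<comment> \<open>The summand \<open>5\<close> in the exponent contributes the factor 32, which
    exceeds 20.\<close>
  then show ?thesis by (simp add: power_add)
qed

text \<open>For \<open>n \<ge> 22\<close> the argument of the logarithm is at most
  \<open>2 * n\<close>. This doubling and the ceiling add at most one each to the summand
  \<open>5\<close>, and the resulting 7 is absorbed because \<open>1 \<le> ln n\<close>.\<close>

lemma word_size_bigo:
  "(\<lambda>n. real (5 + nat \<lceil>log 2 (real (22 + n))\<rceil>)) \<in> O(\<lambda>n. ln (real n))"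
proof (rule bigoI[where c = "7 + 1 / ln 2"], rule eventually_sequentiallyI[of 22])
  fix n :: nat assume n: "22 \<le> n"
  have "log 2 (real (22 + n)) \<le> log 2 (2 * real n)" using n by simp
  also have "\<dots> = 1 + log 2 (real n)" using n by (simp add: log_mult)
  also have "log 2 (real n) = ln (real n) / ln 2" by (rule log_def)
  finally have "log 2 (real (22 + n)) \<le> 1 + ln (real n) / ln 2" .
  moreover have "0 \<le> ln (real n) / ln 2" using n by simp
  ultimately have "real (nat \<lceil>log 2 (real (22 + n))\<rceil>) \<le> 2 + ln (real n) / ln 2"
    by linarith
  moreover have "exp 1 \<le> real n" using exp_le n by linarith
  then have "1 \<le> ln (real n)" using n by (subst ln_ge_iff) auto
  moreover have "(7 + 1 / ln 2) * ln (real n) = 7 * ln (real n) + ln (real n) / ln 2"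
    by (simp add: distrib_right)
  ultimately show "norm (real (5 + nat \<lceil>log 2 (real (22 + n))\<rceil>)) \<le> (7 + 1 / ln 2) * norm (ln (real n))"
    unfolding real_norm_def of_nat_add by linarith
qed

theorem proposition3p8:
  shows "linear_time_decidable encode_pair
    (\<lambda>(u, v). length u + length v)
    (\<lambda>(u, v). conjugate_in lamplighter (word_val u) (word_val v))"
  unfolding linear_time_decidable_def
proof (intro exI conjI allI)
  show "(\<lambda>n. real (1100 * (22 + n))) \<in> O(\<lambda>n. real n)"
  proof (rule bigoI[where c = 2200], rule eventually_sequentiallyI[of 22])
    show "norm (real (1100 * (22 + n))) \<le> 2200 * norm (real n)" if "22 \<le> n" for n
      using that by simp
  qed
  show "(\<lambda>n. real (5 + nat \<lceil>log 2 (real (22 + n))\<rceil>)) \<in> O(\<lambda>n. ln (real n))"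
    by (rule word_size_bigo)
  fix x :: "letter list \<times> letter list"
  obtain u v where x: "x = (u, v)" by (cases x)
  have "20 * (22 + length u + length v) \<le> 2 ^ (5 + nat \<lceil>log 2 (real (22 + (length u + length v)))\<rceil>)"
    using word_size_bound[of "length u + length v"] by (simp only: add.assoc)
  from computes_within_decision_program[OF wp_conjugacy_com[OF this]]
  show "computes_within (decision_program conjugacy_com ans) (encode_pair x)
     (case x of (u, v) \<Rightarrow> conjugate_in lamplighter (word_val u) (word_val v))
     (1100 * (22 + (case x of (u, v) \<Rightarrow> length u + length v)))
     (5 + nat \<lceil>log 2 (real (22 + (case x of (u, v) \<Rightarrow> length u + length v)))\<rceil>)"
    by (simp add: x add.assoc)
qed

end
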